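(* Consider the general linear $D_2Q_{13}$ lattice Boltzmann scheme described in the context, with full equilibrium matrix $E$ and diagonal relaxation matrix $S$ (entries $s_k\in(0,2)$), and let $\sigma_k=1/s_k-1/2>0$. The scheme is isotropic at second order if and only if the following five properties hold: (1) at equilibrium the energy is proportional to the density, i.e. $E_\varepsilon^{q_x}=E_\varepsilon^{q_y}=0$; (2) at equilibrium both moments $m_{\varphi_{xx}}$ and $m_{\varphi_{xy}}$ are zero, i.e. $E_{\varphi_{xx}}^{\rho}=E_{\varphi_{xx}}^{q_x}=E_{\varphi_{xx}}^{q_y}=E_{\varphi_{xy}}^{\rho}=E_{\varphi_{xy}}^{q_x}=E_{\varphi_{xy}}^{q_y}=0$; (3) at equilibrium the heat flux is a rotation-dilatation of the momentum: $m_{\varphi_x}=E_{\varphi_x}^{q_x}\lambda^2q_x+E_{\varphi_x}^{q_y}\lambda^2q_y$ and $m_{\varphi_y}=-E_{\varphi_x}^{q_y}\lambda^2q_x+E_{\varphi_x}^{q_x}\lambda^2q_y$; that is, $E_{\varphi_x}^{\rho}=E_{\varphi_y}^{\rho}=0$, $E_{\varphi_y}^{q_y}=E_{\varphi_x}^{q_x}$, $E_{\varphi_y}^{q_x}=-E_{\varphi_x}^{q_y}$; (4) at equilibrium $(m_{x\varepsilon_2},m_{y\varepsilon_2})$ is a rotation-dilatation of the momentum: $m_{x\varepsilon_2}=E_{x\varepsilon_2}^{q_x}\lambda^4q_x+E_{x\varepsilon_2}^{q_y}\lambda^4q_y$ and $m_{y\varepsilon_2}=-E_{x\varepsilon_2}^{q_y}\lambda^4q_x+E_{x\varepsilon_2}^{q_x}\lambda^4q_y$;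 that is, $E_{x\varepsilon_2}^{\rho}=E_{y\varepsilon_2}^{\rho}=0$, $E_{y\varepsilon_2}^{q_y}=E_{x\varepsilon_2}^{q_x}$, $E_{y\varepsilon_2}^{q_x}=-E_{x\varepsilon_2}^{q_y}$; (5) the equilibrium states are related to the relaxation times by $E_{x\varepsilon_2}^{q_x}=a$ and $E_{x\varepsilon_2}^{q_y}=b$, where $$a=-\frac1{12}\,\frac{7(7\sigma_{\varphi_{xx}}+2\sigma_{\varphi_{xy}})E_{\varphi_x}^{q_x}+5(17\sigma_{\varphi_{xx}}-4\sigma_{\varphi_{xy}})}{\sigma_{\varphi_{xx}}+\sigma_{\varphi_{xy}}},\qquad b=\frac7{12}\,E_{\varphi_y}^{q_x}\,\frac{7\sigma_{\varphi_{xx}}+2\sigma_{\varphi_{xy}}}{\sigma_{\varphi_{xx}}+\sigma_{\varphi_{xy}}}.$$ (All other coefficients of $E$ are arbitrary and there is no constraint on $S$.)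
   Context: **Lattice and velocities.** Space dimension $d=2$; the velocity scale $\lambda>0$ is fixed, and $\Delta t=\Delta x/\lambda$. The $D_2Q_{13}$ scheme has $q=13$ velocities $v_j=(v_j^x,v_j^y)$: $(0,0)$, $(\pm\lambda,0)$, $(0,\pm\lambda)$, $(\pm\lambda,\pm\lambda)$, $(\pm2\lambda,0)$, $(0,\pm2\lambda)$. The distribution is $f=(f_j)_{0\le j\le 12}$. **Moments.** The moment vector is $(W,Y)=Mf$, where each moment is $\sum_j p(v_j)f_j$ for the polynomial $p(v)$ below, with $v=(v^x,v^y)$ and $|v|^2=(v^x)^2+(v^y)^2$. Conserved moments $W=(\rho,q_x,q_y)$ ($N=3$): $1,\ v^x,\ v^y$. Non-conserved moments $Y=(m_\varepsilon,m_{\varphi_{xx}},m_{\varphi_{xy}},m_{\varphi_x},m_{\varphi_y},m_{x\varepsilon_2},m_{y\varepsilon_2},m_{\varepsilon_2},m_{\varepsilon_3},m_{xx\varepsilon})$, orthogonalized (the rows of $M$ are pairwise orthogonal): - $m_\varepsilon$: $13|v|^2-28\lambda^2$; - $m_{\varphi_{xx}}$: $(v^x)^2-(v^y)^2$; $m_{\varphi_{xy}}$: $v^xv^y$; - $m_{\varphi_x}$: $(|v|^2-3\lambda^2)v^x$; $m_{\varphi_y}$: $(|v|^2-3\lambda^2)v^y$ (heat flux); - $m_{x\varepsilon_2}$: $(\tfrac{35}{12}|v|^4-\tfrac{63}{4}\lambda^2|v|^2+\tfrac{101}{6}\lambda^4)v^x$; $m_{y\varepsilon_2}$: the same with $v^y$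 in place of the last factor $v^x$; - $m_{\varepsilon_2}$: $\tfrac{77}{2}|v|^4-\tfrac{361}{2}\lambda^2|v|^2+140\lambda^4$; - $m_{\varepsilon_3}$: $\tfrac{137}{24}|v|^6-\tfrac{273}{8}\lambda^2|v|^4+\tfrac{581}{12}\lambda^4|v|^2-12\lambda^6$; - $m_{xx\varepsilon}$: $(\tfrac{17}{12}|v|^2-\tfrac{65}{12}\lambda^2)\bigl((v^x)^2-(v^y)^2\bigr)$. **Equilibrium and relaxation.** $Y^{eq}=EW$ with a full real $10\times3$ matrix $E$. Its row associated with the non-conserved moment $m_k$, $k\in\{\varepsilon,\varphi_{xx},\varphi_{xy},\varphi_x,\varphi_y,x\varepsilon_2,y\varepsilon_2,\varepsilon_2,\varepsilon_3,xx\varepsilon\}$, is $(E_k^{\rho}\lambda^{p_k},\,E_k^{q_x}\lambda^{p_k-1},\,E_k^{q_y}\lambda^{p_k-1})$, where $p_k$ is the total degree in velocities of the moment ($p_k=2,2,2,3,3,5,5,4,6,4$ respectively). $S=\mathrm{Diag}(s_k)$ (same ordering), $0<s_k<2$. The relaxation step is $W^*=W$, $Y^*=Y+S(EW-Y)$, i.e. multiplication of the moment vector by $J=\begin{pmatrix} \mathrm{Id}_3 & 0 \\ S\,E & \mathrm{Id}_{10}-S \end{pmatrix}$. With $f^*=M^{-1}JMf$, one time step is $f_j(x+v_j\Delta t,t+\Delta t)=f_j^*(x,t)$. **Equivalent equations.** Formally, in terms of constant-coefficient differential operators, one time step is $f(t+\Delta t)=e^{-\Delta t\,\Lambda}M^{-1}JM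 f(t)$ with $\Lambda=\mathrm{diag}(v_j\cdot\nabla)$. There is a unique pair of formal power series in $\Delta t$, with coefficients matrices of constant-coefficient differential operators in $(x,y)$, consisting of a $13\times3$ matrix $\Psi$ whose first three rows form $\mathrm{Id}_3$ and a $3\times3$ matrix $\mathcal A$, such that $Me^{-\Delta t\Lambda}M^{-1}J\,\Psi=\Psi\,e^{-\Delta t\mathcal A}$. It has the form $\mathcal A=\sum_{n\ge1}\Delta t^{\,n-1}A_n\odot\nabla^n$, where $(A_n\odot\nabla^nW)^i=\sum_{j=1}^{3}\sum_{\alpha_1,\dots,\alpha_n\in\{1,2\}}A_{n,j}^{i,\alpha_1\cdots\alpha_n}\partial_{\alpha_1}\cdots\partial_{\alpha_n}W^j$ and $A_n$ does not depend on $\Delta t$. The equivalent equations of order $m$ are $\partial_tW+\sum_{n=1}^m\Delta t^{\,n-1}A_n\odot\nabla^nW=0$. Tensors $A_n$ are identified when they define the same differential operator (equivalently, they are taken symmetric in $\alpha_1,\dots,\alpha_n$). **Isotropy.** For $r\in SO_2(\mathbb R)$ let $R(r)=\begin{pmatrix}1&0\\0&r\end{pmatrix}$ and $$\bigl(\Phi_n(r)(A)\bigr)^{i,\alpha_1\cdots\alpha_n}_j=\sum_{\beta_1,\dots,\beta_n=1}^{2}\ \sum_{k,l=1}^{3}R(r)^i_l\,A^{l,\beta_1\cdots\beta_n}_k\,r^{\alpha_1}_{\beta_1}\cdots r^{\alpha_n}_{\beta_n}\,(R(r)^{-1})^k_j .$$ The scheme is isotropic at order $m$ if $\Phi_n(r)(A_n)=A_n$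 for all $r\in SO_2(\mathbb R)$ and all $1\le n\le m$. *)

theory Defs
  imports
    "HOL-Analysis.Analysis"
    "HOL-Computational_Algebra.Formal_Power_Series"
begin

section \<open>Velocities, moments and one collision step\<close>

datatype vel = F0 | F1 | F2 | F3 | F4 | F5 | F6 | F7 | F8 | F9 | F10 | F11 | F12

lemma UNIV_vel: "(UNIV :: vel set) = {F0, F1, F2, F3, F4, F5, F6, F7, F8, F9, F10, F11, F12}"
proof -
  have "j \<in> {F0, F1, F2, F3, F4, F5, F6, F7, F8, F9, F10, F11, F12}" for j :: vel
    by (cases j) simp_all
  then show ?thesis by blast
qed

instance vel :: finite
  by standard (simp add: UNIV_vel)

primrec stencil :: "vel \<Rightarrow> real^2" where
  "stencil F0 = vector [0, 0]"
| "stencil F1 = vector [1, 0]"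
| "stencil F2 = vector [-1, 0]"
| "stencil F3 = vector [0, 1]"
| "stencil F4 = vector [0, -1]"
| "stencil F5 = vector [1, 1]"
| "stencil F6 = vector [-1, 1]"
| "stencil F7 = vector [-1, -1]"
| "stencil F8 = vector [1, -1]"
| "stencil F9 = vector [2, 0]"
| "stencil F10 = vector [-2, 0]"
| "stencil F11 = vector [0, 2]"
| "stencil F12 = vector [0, -2]"

definition velocity :: "real \<Rightarrow> vel \<Rightarrow> real^2" where
  "velocity lam j = lam *\<^sub>R stencil j"

datatype nonconserved =
  Energy | Phi_xx | Phi_xy | Phi_x | Phi_y | X_eps2 | Y_eps2 | Eps2 | Eps3 | XX_eps

lemma UNIV_nonconserved:
  "(UNIV :: nonconserved set)
     = {Energy, Phi_xx, Phi_xy, Phi_x, Phi_y, X_eps2, Y_eps2, Eps2, Eps3, XX_eps}"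
proof -
  have "k \<in> {Energy, Phi_xx, Phi_xy, Phi_x, Phi_y, X_eps2, Y_eps2, Eps2, Eps3, XX_eps}"
    for k :: nonconserved
    by (cases k) simp_all
  then show ?thesis by blast
qed

instance nonconserved :: finite
  by standard (simp add: UNIV_nonconserved)

text \<open>The conserved moments \<open>\<rho>, q\<^sub>x, q\<^sub>y\<close> are indexed by the type \<open>3\<close>, in this order (so that the
  index of \<open>q\<^sub>y\<close> is \<open>3\<close>); the full moment vector is indexed by the sum type.\<close>

type_synonym moment = "3 + nonconserved"

definition conserved_poly :: "3 \<Rightarrow> real^2 \<Rightarrow> real" where
  "conserved_poly i v = (vector [1, v$1, v$2] :: real^3) $ i"

primrec nonconserved_poly :: "nonconserved \<Rightarrow> real \<Rightarrow> real^2 \<Rightarrow> real" where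
  "nonconserved_poly Energy lam v = 13 * (norm v)^2 - 28 * lam^2"
| "nonconserved_poly Phi_xx lam v = (v$1)^2 - (v$2)^2"
| "nonconserved_poly Phi_xy lam v = v$1 * v$2"
| "nonconserved_poly Phi_x lam v = ((norm v)^2 - 3 * lam^2) * v$1"
| "nonconserved_poly Phi_y lam v = ((norm v)^2 - 3 * lam^2) * v$2"
| "nonconserved_poly X_eps2 lam v =
     (35/12 * (norm v)^4 - 63/4 * lam^2 * (norm v)^2 + 101/6 * lam^4) * v$1"
| "nonconserved_poly Y_eps2 lam v =
     (35/12 * (norm v)^4 - 63/4 * lam^2 * (norm v)^2 + 101/6 * lam^4) * v$2"
| "nonconserved_poly Eps2 lam v =
     77/2 * (norm v)^4 - 361/2 * lam^2 * (norm v)^2 + 140 * lam^4"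
| "nonconserved_poly Eps3 lam v =
     137/24 * (norm v)^6 - 273/8 * lam^2 * (norm v)^4 + 581/12 * lam^4 * (norm v)^2 - 12 * lam^6"
| "nonconserved_poly XX_eps lam v =
     (17/12 * (norm v)^2 - 65/12 * lam^2) * ((v$1)^2 - (v$2)^2)"

primrec moment_degree :: "nonconserved \<Rightarrow> nat" where
  "moment_degree Energy = 2"
| "moment_degree Phi_xx = 2"
| "moment_degree Phi_xy = 2"
| "moment_degree Phi_x = 3"
| "moment_degree Phi_y = 3"
| "moment_degree X_eps2 = 5"
| "moment_degree Y_eps2 = 5"
| "moment_degree Eps2 = 4"
| "moment_degree Eps3 = 6"
| "moment_degree XX_eps = 4"

definition moment_matrix :: "real \<Rightarrow> real^vel^moment" where
  "moment_matrix lam = (\<chi> i j. case i of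
      Inl c \<Rightarrow> conserved_poly c (velocity lam j)
    | Inr k \<Rightarrow> nonconserved_poly k lam (velocity lam j))"

text \<open>\<open>E\<close> contains the dimensionless coefficients: \<open>E $ k $ 1\<close>, \<open>E $ k $ 2\<close>, \<open>E $ k $ 3\<close> are the
  coefficients of \<open>\<rho>, q\<^sub>x, q\<^sub>y\<close> in the equilibrium value of moment \<open>k\<close>.\<close>

definition equilibrium_matrix :: "real \<Rightarrow> real^3^nonconserved \<Rightarrow> real^3^nonconserved" where
  "equilibrium_matrix lam E =
     (\<chi> k j. E $ k $ j * (if j = 1 then lam ^ moment_degree k else lam ^ (moment_degree k - 1)))"

definition relaxation_matrix :: "(nonconserved \<Rightarrow> real) \<Rightarrow> real^nonconserved^nonconserved" where
  "relaxation_matrix s = (\<chi> k l. if k = l then s k else 0)"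

definition collision_matrix ::
  "real \<Rightarrow> (nonconserved \<Rightarrow> real) \<Rightarrow> real^3^nonconserved \<Rightarrow> real^moment^moment" where
  "collision_matrix lam s E = (\<chi> i j. case (i, j) of
      (Inl a, Inl b) \<Rightarrow> (mat 1 :: real^3^3) $ a $ b
    | (Inl a, Inr l) \<Rightarrow> 0
    | (Inr k, Inl b) \<Rightarrow> (relaxation_matrix s ** equilibrium_matrix lam E) $ k $ b
    | (Inr k, Inr l) \<Rightarrow> (mat 1 - relaxation_matrix s) $ k $ l)"

definition relax_sigma :: "(nonconserved \<Rightarrow> real) \<Rightarrow> nonconserved \<Rightarrow> real" where
  "relax_sigma s k = 1 / s k - 1 / 2"


section \<open>Formal expansion of the scheme\<close>

text \<open>Constant-coefficient differential operators in \<open>(x, y)\<close> are polynomials in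
  \<open>\<partial>\<^sub>1 = \<partial>\<^sub>x\<close> (the inner variable) and \<open>\<partial>\<^sub>2 = \<partial>\<^sub>y\<close> (the outer variable); \<open>\<Delta>t\<close> is \<^const>\<open>fps_X\<close>.
  A power series with matrix coefficients is represented as a matrix of power series.\<close>

type_synonym diffop = "real poly poly"

definition scalar_op :: "real \<Rightarrow> diffop" where
  "scalar_op c = [:[:c:]:]"

definition partial_op :: "2 \<Rightarrow> diffop" where
  "partial_op \<alpha> = (if \<alpha> = 1 then [:[:0, 1:]:] else [:0, 1:])"

definition real_matrix :: "real^'n^'m \<Rightarrow> diffop fps^'n^'m" where
  "real_matrix B = map_matrix (\<lambda>c. fps_const (scalar_op c)) B"

text \<open>\<open>exp_mdt B\<close> is \<open>exp (- \<Delta>t B) = (\<Sum>k. (- \<Delta>t B)\<^sup>k / k!)\<close>. The entries of the \<open>k\<close>-th term are divisible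
  by \<open>\<Delta>t\<^sup>k\<close>, so that only the terms with \<open>k \<le> n\<close> contribute to the coefficient of \<open>\<Delta>t\<^sup>n\<close>.\<close>

definition exp_mdt :: "diffop fps^'n^'n \<Rightarrow> diffop fps^'n^'n" where
  "exp_mdt B = (\<chi> i j. Abs_fps (\<lambda>n. \<Sum>k\<le>n. scalar_op (1 / fact k) *
      fps_nth ((((**) (map_matrix (\<lambda>b. - fps_X * b) B) ^^ k) (mat 1)) $ i $ j) n))"

definition advection_matrix :: "real \<Rightarrow> diffop fps^vel^vel" where
  "advection_matrix lam = (\<chi> i j. if i = j
      then fps_const (\<Sum>\<alpha>\<in>UNIV. scalar_op (velocity lam j $ \<alpha>) * partial_op \<alpha>) else 0)"

definition formal_expansion ::
  "real \<Rightarrow> (nonconserved \<Rightarrow> real) \<Rightarrow> real^3^nonconserved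
     \<Rightarrow> diffop fps^3^moment \<Rightarrow> diffop fps^3^3 \<Rightarrow> bool" where
  "formal_expansion lam s E Psi A \<longleftrightarrow>
     (\<forall>i j. Psi $ Inl i $ j = mat 1 $ i $ j) \<and>
     real_matrix (moment_matrix lam) ** exp_mdt (advection_matrix lam)
         ** real_matrix (matrix_inv (moment_matrix lam))
         ** real_matrix (collision_matrix lam s E) ** Psi
       = Psi ** exp_mdt A"

definition equivalent_operator ::
  "real \<Rightarrow> (nonconserved \<Rightarrow> real) \<Rightarrow> real^3^nonconserved \<Rightarrow> diffop fps^3^3" where
  "equivalent_operator lam s E = (THE A. \<exists>Psi. formal_expansion lam s E Psi A)"


section \<open>Tensors and isotropy\<close>

text \<open>A tensor with \<open>n\<close> spatial indices is a function on the index lists of length \<open>n\<close>, extended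
  by \<open>0\<close> to all other lists; \<open>A \<alpha>s $ i $ j\<close> is the component with upper indices
  \<open>i, \<alpha>\<^sub>1, \<dots>, \<alpha>\<^sub>n\<close> and lower index \<open>j\<close>. Symmetry in the spatial indices singles out one tensor
  among those which define the same differential operator.\<close>

type_synonym tensor = "2 list \<Rightarrow> real^3^3"

definition symmetric_tensor :: "nat \<Rightarrow> tensor \<Rightarrow> bool" where
  "symmetric_tensor n A \<longleftrightarrow>
     (\<forall>\<alpha>s. length \<alpha>s \<noteq> n \<longrightarrow> A \<alpha>s = 0) \<and>
     (\<forall>\<alpha>s \<beta>s. mset \<alpha>s = mset \<beta>s \<longrightarrow> A \<alpha>s = A \<beta>s)"

definition tensor_nabla :: "nat \<Rightarrow> tensor \<Rightarrow> diffop^3^3" where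
  "tensor_nabla n A = (\<chi> i j. \<Sum>\<alpha>s | length \<alpha>s = n.
      scalar_op (A \<alpha>s $ i $ j) * prod_list (map partial_op \<alpha>s))"

definition equivalent_tensor ::
  "real \<Rightarrow> (nonconserved \<Rightarrow> real) \<Rightarrow> real^3^nonconserved \<Rightarrow> nat \<Rightarrow> tensor" where
  "equivalent_tensor lam s E n = (THE A. symmetric_tensor n A \<and>
      tensor_nabla n A = map_matrix (\<lambda>a. fps_nth a (n - 1)) (equivalent_operator lam s E))"

definition rotation_rep :: "real^2^2 \<Rightarrow> real^3^3" where
  "rotation_rep r = vector [vector [1, 0, 0],
                            vector [0, r$1$1, r$1$2],
                            vector [0, r$2$1, r$2$2]]"

definition rotate_tensor :: "nat \<Rightarrow> real^2^2 \<Rightarrow> tensor \<Rightarrow> tensor" where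
  "rotate_tensor n r A \<alpha>s = (\<chi> i j. \<Sum>\<beta>s | length \<beta>s = n. \<Sum>k\<in>UNIV. \<Sum>l\<in>UNIV.
      rotation_rep r $ i $ l * A \<beta>s $ l $ k * (\<Prod>m<n. r $ (\<alpha>s ! m) $ (\<beta>s ! m))
        * matrix_inv (rotation_rep r) $ k $ j)"

definition isotropic_at_order ::
  "real \<Rightarrow> (nonconserved \<Rightarrow> real) \<Rightarrow> real^3^nonconserved \<Rightarrow> nat \<Rightarrow> bool" where
  "isotropic_at_order lam s E m \<longleftrightarrow>
     (\<forall>r. rotation_matrix r \<longrightarrow> (\<forall>n\<in>{1..m}. \<forall>\<alpha>s. length \<alpha>s = n \<longrightarrow>
        rotate_tensor n r (equivalent_tensor lam s E n) \<alpha>s = equivalent_tensor lam s E n \<alpha>s))"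

end

theory Submission
  imports Defs
begin

text \<open>Write the collision operator in the moment basis as a block matrix and split \<open>\<Psi>\<close> into
  the identity and a nonconserved block \<open>Y\<close>. Eliminating \<open>exp (- \<Delta>t \<A>)\<close> turns the defining
  equation into a Riccati equation \<open>Y = E + \<Delta>t S\<^sup>-\<^sup>1 (\<dots>)\<close>, whose right-hand side is contracting for
  the \<open>\<Delta>t\<close>-adic distance; this gives existence and uniqueness of \<open>\<A>\<close>. With
  \<open>D = M \<Lambda> M\<^sup>-\<^sup>1 = [[a, b], [c, d]]\<close>, comparing the first three coefficients yields
  \<open>A\<^sub>1 = a + b E\<close> and \<open>A\<^sub>2 = b \<Sigma> (E A\<^sub>1 - (c + d E))\<close> with \<open>\<Sigma> = S\<^sup>-\<^sup>1 - 1/2\<close>. The rows of \<open>b\<close> only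
  involve the moments \<open>\<epsilon>, xx, xy\<close>, so only these rows of \<open>c + d E\<close> matter. Invariance of \<open>A\<^sub>1\<close>
  forces (1) and (2), after which \<open>A\<^sub>2\<close> is affine in the remaining coefficients of \<open>E\<close>.\<close>

section \<open>Matrices of formal power series\<close>

text \<open>\<open>equivalent_operator\<close> and \<open>equivalent_tensor\<close> are definite
  descriptions, so no component can be computed before existence and uniqueness are settled; this is
  why formal series come first. The 1/2 in \<Sigma> is what remains of the quadratic terms of the
  two exponentials: they differ by half of D applied to the first-order defect. The dependence on
  \<open>lam\<close> is homogeneity and factors out. The conditions on A_2 separate into two kinds.
  Homogeneous pairs of equations for the density coefficients and for the deviations from a
  rotation-dilatation have only the zero solution, because \<sigma> is positive for the moments
  \<epsilon>, xx and xy; they give (3) and (4). Two conditions of angular degree 4 remain; the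
  energy terms cancel in them, and they give (5).\<close>

definition coeff_matrix :: "'a::zero fps^'n^'m \<Rightarrow> nat \<Rightarrow> 'a^'n^'m" where
  "coeff_matrix A n = map_matrix (\<lambda>a. fps_nth a n) A"

lemma coeff_matrix_nth [simp]: "coeff_matrix A n $ i $ j = fps_nth (A $ i $ j) n"
  by (simp add: coeff_matrix_def)

lemma fps_matrix_eqI: "(\<And>n. coeff_matrix A n = coeff_matrix B n) \<Longrightarrow> A = B"
  by (simp add: vec_eq_iff fps_eq_iff)

lemma coeff_matrix_mult:
  fixes A :: "'a::comm_ring_1 fps^'n^'m" and B :: "'a fps^'k^'n"
  shows "coeff_matrix (A ** B) n = (\<Sum>i\<le>n. coeff_matrix A i ** coeff_matrix B (n - i))"
proof -
  have "fps_nth (\<Sum>k\<in>UNIV. A $ i $ k * B $ k $ j) n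
      = (\<Sum>l\<le>n. \<Sum>k\<in>UNIV. fps_nth (A $ i $ k) l * fps_nth (B $ k $ j) (n - l))" for i j
    by (simp add: fps_sum_nth fps_mult_nth atLeast0AtMost) (rule sum.swap)
  then show ?thesis
    by (simp add: vec_eq_iff matrix_matrix_mult_def)
qed

text \<open>Congruence modulo \<open>fps_X ^ n\<close>. \<open>agree 0\<close> always holds, which
  starts the inductions.\<close>

definition agree :: "nat \<Rightarrow> 'a::zero fps^'n^'m \<Rightarrow> 'a fps^'n^'m \<Rightarrow> bool" where
  "agree n A B \<longleftrightarrow> (\<forall>m<n. coeff_matrix A m = coeff_matrix B m)"

lemma agree_mult:
  fixes A A' :: "'a::comm_ring_1 fps^'n^'m"
  assumes "agree n A A'" "agree n B B'"
  shows "agree n (A ** B) (A' ** B')"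
  using assms by (auto simp: agree_def coeff_matrix_mult intro!: sum.cong)

text \<open>Banach's fixed point theorem for the \<Delta>t-adic metric: each application of
  \<open>F\<close> settles one more coefficient, so the iterates of 0 converge
  coefficientwise.\<close>

lemma fps_matrix_fixpoint:
  fixes F :: "'a::zero fps^'n^'m \<Rightarrow> 'a fps^'n^'m"
  assumes contr: "\<And>n A B. agree n A B \<Longrightarrow> agree (Suc n) (F A) (F B)"
  shows "\<exists>!A. F A = A"
proof -
  \<comment> \<open>Coefficient \<open>n\<close> no longer changes after \<open>Suc n\<close>
    iterations, so the limit is read off diagonally.\<close>
  define Y :: "'a fps^'n^'m" where
    "Y = (\<chi> i j. Abs_fps (\<lambda>n. fps_nth ((F ^^ Suc n) 0 $ i $ j) n))"
  have step: "agree n ((F ^^ n) 0) ((F ^^ (n + k)) 0)" for n k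
    by (induction n) (simp_all add: agree_def[of 0] contr)
  have Y: "agree n Y ((F ^^ n) 0)" for n
  proof -
    have "coeff_matrix Y m = coeff_matrix ((F ^^ n) 0) m" if "m < n" for m
    proof -
      have "coeff_matrix Y m = coeff_matrix ((F ^^ Suc m) 0) m"
        by (simp add: Y_def vec_eq_iff)
      also have "\<dots> = coeff_matrix ((F ^^ (Suc m + (n - Suc m))) 0) m"
        using step[of "Suc m" "n - Suc m"] unfolding agree_def by blast
      finally show ?thesis using that by simp
    qed
    then show ?thesis by (simp add: agree_def)
  qed
  have "F Y = Y"
  proof (rule fps_matrix_eqI)
    fix n
    have "agree (Suc n) (F Y) ((F ^^ Suc n) 0)" using contr[OF Y[of n]] by simp
    then show "coeff_matrix (F Y) n = coeff_matrix Y n"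
      using Y[of "Suc n"] by (simp add: agree_def)
  qed
  moreover have "A = Y" if "F A = A" for A
  proof -
    have "agree n A Y" for n
      by (induction n) (use contr[of _ A Y] that \<open>F Y = Y\<close> in \<open>auto simp: agree_def[of 0]\<close>)
    then show ?thesis by (intro fps_matrix_eqI) (auto simp: agree_def)
  qed
  ultimately show ?thesis by blast
qed

section \<open>Formal exponentials of matrices\<close>

definition matpow :: "'a::comm_ring_1^'n^'n \<Rightarrow> nat \<Rightarrow> 'a^'n^'n" where
  "matpow B k = (((**) B) ^^ k) (mat 1)"

lemma matpow_0 [simp]: "matpow B 0 = mat 1" and matpow_Suc: "matpow B (Suc k) = B ** matpow B k"
  by (simp_all add: matpow_def)

lemma matpow_scaled:
  fixes B :: "'a::comm_ring_1^'n^'n"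
  shows "matpow (map_matrix (\<lambda>b. c * b) B) k = map_matrix (\<lambda>b. c ^ k * b) (matpow B k)"
  by (induction k)
    (simp_all add: vec_eq_iff matpow_Suc matrix_matrix_mult_def sum_distrib_left mult_ac)

text \<open>The factor - \<Delta>t leaves the \<open>k\<close>-th power as (- \<Delta>t)^k, which
  moves the index from \<open>n\<close> to \<open>n - k\<close>.\<close>

lemma exp_mdt_nth:
  "fps_nth (exp_mdt B $ i $ j) n
    = (\<Sum>k\<le>n. scalar_op (1 / fact k) * ((-1) ^ k * fps_nth (matpow B k $ i $ j) (n - k)))"
proof -
  have "fps_nth ((- fps_X) ^ k * b) n = (-1) ^ k * fps_nth b (n - k)" if "k \<le> n" for k and b :: "diffop fps"
  proof -
    have "(- fps_X :: diffop fps) ^ k = fps_const ((-1) ^ k) * fps_X ^ k"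
      by (subst power_minus) (metis fps_const_1_eq_1 fps_const_neg fps_const_power)
    then have "(- fps_X) ^ k * b = fps_const ((-1) ^ k) * (fps_X ^ k * b)"
      by (simp only: mult.assoc)
    then show ?thesis
      using that by (simp only: fps_mult_left_const_nth fps_X_power_mult_nth) simp
  qed
  then show ?thesis
    unfolding exp_mdt_def matpow_def[symmetric] matpow_scaled by simp
qed

lemma agree_matpow: "agree n A B \<Longrightarrow> agree n (matpow A k) (matpow B k)"
  by (induction k) (simp_all add: agree_def[of _ "mat 1"] matpow_Suc agree_mult)

lemma scalar_op_0 [simp]: "scalar_op 0 = 0"
  and scalar_op_1 [simp]: "scalar_op 1 = 1"
  and scalar_op_add: "scalar_op (a + b) = scalar_op a + scalar_op b"
  and scalar_op_diff: "scalar_op (a - b) = scalar_op a - scalar_op b"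
  and scalar_op_mult: "scalar_op (a * b) = scalar_op a * scalar_op b"
  by (simp_all add: scalar_op_def one_pCons)

lemma scalar_op_sum: "scalar_op (sum f A) = (\<Sum>x\<in>A. scalar_op (f x))"
  by (induction A rule: infinite_finite_induct) (simp_all add: scalar_op_add)

text \<open>Stands in for the matrix logarithm: it recovers \<open>A\<close> once the conserved rows
  have determined exp (- \<Delta>t A).\<close>

lemma exp_mdt_bij:
  fixes X :: "diffop fps^'n^'n"
  assumes "coeff_matrix X 0 = mat 1"
  shows "\<exists>!A. exp_mdt A = X"
proof -
  \<comment> \<open>The coefficient of \<open>\<Delta>t\<^sup>n\<^sup>+\<^sup>1\<close> in \<open>exp (- \<Delta>t A)\<close> is \<open>- A\<^sub>n\<close> up to terms in \<open>A\<^sub>0, \<dots>, A\<^sub>n\<^sub>-\<^sub>1\<close>,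
    so adding \<open>A\<close> makes the shifted difference contracting.\<close>
  define F where "F A = (\<chi> i j. A $ i $ j + fps_shift 1 (exp_mdt A $ i $ j - X $ i $ j))" for A
  have "agree (Suc n) (F A) (F B)" if AB: "agree n A B" for n A B
  proof -
    have "fps_nth (A $ i $ j) m + fps_nth (exp_mdt A $ i $ j) (Suc m)
        = fps_nth (B $ i $ j) m + fps_nth (exp_mdt B $ i $ j) (Suc m)" if "m < Suc n" for m i j
    proof -
      have *: "fps_nth (A $ i $ j) m + fps_nth (exp_mdt A $ i $ j) (Suc m)
          = (\<Sum>k<m. scalar_op (1 / fact (Suc (Suc k))) *
               ((-1) ^ (Suc (Suc k)) * fps_nth (matpow A (Suc (Suc k)) $ i $ j) (m - Suc k)))
            + fps_nth ((mat 1 :: diffop fps^'n^'n) $ i $ j) (Suc m)" for A :: "diffop fps^'n^'n"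
        unfolding exp_mdt_nth sum.atMost_Suc_shift lessThan_Suc_atMost[symmetric] sum.lessThan_Suc_shift
        by (simp add: matpow_Suc[of A 0])
      have "fps_nth (matpow A k $ i $ j) (m - Suc l) = fps_nth (matpow B k $ i $ j) (m - Suc l)"
        if "l < m" for k l
      proof -
        have "m - Suc l < n" using that \<open>m < Suc n\<close> by simp
        then have "coeff_matrix (matpow A k) (m - Suc l) = coeff_matrix (matpow B k) (m - Suc l)"
          using agree_matpow[OF AB, of k] unfolding agree_def by blast
        then show ?thesis by (metis coeff_matrix_nth)
      qed
      then show ?thesis unfolding * by (intro arg_cong2[of _ _ _ _ "(+)"] sum.cong) auto
    qed
    then show ?thesis
      by (auto simp: agree_def vec_eq_iff F_def algebra_simps)
  qed
  then have "\<exists>!A. F A = A" by (rule fps_matrix_fixpoint)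
  moreover have "F A = A \<longleftrightarrow> exp_mdt A = X" for A
  proof -
    have "exp_mdt A = X \<longleftrightarrow> (\<forall>i j n. fps_nth (exp_mdt A $ i $ j) n = fps_nth (X $ i $ j) n)"
      by (auto simp: vec_eq_iff fps_eq_iff)
    \<comment> \<open>The shift in \<open>F\<close> drops the constant coefficients; nothing is
      lost, since both are \<open>mat 1\<close>.\<close>
    also have "\<dots> \<longleftrightarrow> (\<forall>i j n. fps_nth (exp_mdt A $ i $ j) (Suc n) = fps_nth (X $ i $ j) (Suc n))"
    proof -
      have "fps_nth (exp_mdt A $ i $ j) 0 = fps_nth (X $ i $ j) 0" for i j
        using assms by (simp add: exp_mdt_nth vec_eq_iff mat_def)
      then show ?thesis by (metis old.nat.exhaust)
    qed
    also have "\<dots> \<longleftrightarrow> F A = A"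
      by (simp add: F_def vec_eq_iff fps_eq_iff)
    finally show ?thesis by blast
  qed
  ultimately show ?thesis by simp
qed

lemma coeff_exp_mdt:
  "coeff_matrix (exp_mdt B) 0 = mat 1"
  "coeff_matrix (exp_mdt B) (Suc 0) = - coeff_matrix B 0"
  "coeff_matrix (exp_mdt B) 2 =
     map_matrix ((*) (scalar_op (1/2))) (coeff_matrix B 0 ** coeff_matrix B 0) - coeff_matrix B 1"
proof -
  have B1: "matpow B (Suc 0) = B" by (simp add: matpow_Suc)
  have B2: "fps_nth (matpow B 2 $ i $ j) 0 = (coeff_matrix B 0 ** coeff_matrix B 0) $ i $ j" for i j
    by (simp add: numeral_2_eq_2 matpow_Suc) (simp add: matrix_matrix_mult_def fps_sum_nth)
  show "coeff_matrix (exp_mdt B) 0 = mat 1"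
    "coeff_matrix (exp_mdt B) (Suc 0) = - coeff_matrix B 0"
    by (simp_all add: vec_eq_iff exp_mdt_nth B1) (simp_all add: mat_def)
  have "{..2::nat} = {0,1,2}" by auto
  then show "coeff_matrix (exp_mdt B) 2 =
     map_matrix ((*) (scalar_op (1/2))) (coeff_matrix B 0 ** coeff_matrix B 0) - coeff_matrix B 1"
    by (simp add: vec_eq_iff exp_mdt_nth B2 B1) (simp add: mat_def)
qed

section \<open>Existence and uniqueness of the equivalent operator\<close>

lemma sum_moment: "(\<Sum>i\<in>UNIV. f i) = (\<Sum>a\<in>UNIV. f (Inl a)) + (\<Sum>k\<in>UNIV. f (Inr k))"
  for f :: "'a::finite + 'b::finite \<Rightarrow> 'c::comm_monoid_add"
  using sum.Plus[of UNIV UNIV f] by (simp add: UNIV_Plus_UNIV o_def)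

abbreviation op_matrix :: "real^'n^'m \<Rightarrow> diffop^'n^'m" where
  "op_matrix \<equiv> map_matrix scalar_op"

lemma op_matrix_mult: "op_matrix (A ** B) = op_matrix A ** op_matrix B"
  by (simp add: vec_eq_iff matrix_matrix_mult_def scalar_op_sum scalar_op_mult)

lemma op_matrix_1: "op_matrix (mat 1) = mat 1"
  by (simp add: vec_eq_iff mat_def)

lemma coeff_real_matrix_mult:
  "coeff_matrix (real_matrix B ** C) n = op_matrix B ** coeff_matrix C n"
  "coeff_matrix (C' ** real_matrix B) n = coeff_matrix C' n ** op_matrix B"
  by (simp_all add: vec_eq_iff matrix_matrix_mult_def real_matrix_def fps_sum_nth)

lemma matrix_minus_mult: "(- A) ** B = - (A ** B)" for A :: "'a::comm_ring_1^'n^'m"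
  by (simp add: vec_eq_iff matrix_matrix_mult_def sum_negf)

lemma matrix_mult_minus: "A ** (- B) = - (A ** B)" for A :: "'a::comm_ring_1^'n^'m"
  by (simp add: vec_eq_iff matrix_matrix_mult_def sum_negf)

lemma matrix_diff_ldistrib: "C ** (A - B) = C ** A - C ** B" for A :: "'a::comm_ring_1^'n^'m"
  by (simp add: vec_eq_iff matrix_matrix_mult_def sum_subtractf right_diff_distrib)

lemma map_matrix_scale_mult:
  "map_matrix ((*) c) A ** B = map_matrix ((*) c) (A ** B)"
  "A ** map_matrix ((*) c) B = map_matrix ((*) c) (A ** B)" for A :: "'a::comm_ring_1^'n^'m"
  by (simp_all add: vec_eq_iff matrix_matrix_mult_def sum_distrib_left mult_ac)

text \<open>The shape that \<open>formal_expansion\<close> imposes on \<open>Psi\<close>, leaving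
  the nonconserved block as the only unknown. It is polymorphic because real equilibrium matrices
  are extended in the same way.\<close>

definition stack :: "'a::zero_neq_one^3^nonconserved \<Rightarrow> 'a^3^moment" where
  "stack Y = (\<chi> i j. case i of Inl a \<Rightarrow> mat 1 $ a $ j | Inr k \<Rightarrow> Y $ k $ j)"

lemma stack_nth [simp]: "stack Y $ Inl a $ j = mat 1 $ a $ j" "stack Y $ Inr k $ j = Y $ k $ j"
  by (simp_all add: stack_def)

text \<open>The top block of \<open>stack Y\<close> is the identity, so
  \<open>upper (stack Y ** X)\<close> is \<open>X\<close>; this is how \<open>exp_mdt A\<close> gets
  eliminated.\<close>

definition upper :: "'a^3^moment \<Rightarrow> 'a^3^3" where
  "upper P = (\<chi> i j. P $ Inl i $ j)"

lemma upper_nth [simp]: "upper P $ i $ j = P $ Inl i $ j" by (simp add: upper_def)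

lemma matrix_eqI_moment:
  "(\<And>a j. P $ Inl a $ j = Q $ Inl a $ j) \<Longrightarrow> (\<And>k j. P $ Inr k $ j = Q $ Inr k $ j) \<Longrightarrow> P = Q"
  for P Q :: "'a^3^moment"
  by (simp add: vec_eq_iff) (metis sum.exhaust)

lemma collision_matrix_nth:
  "collision_matrix lam s E $ Inl a $ Inl b = mat 1 $ a $ b"
  "collision_matrix lam s E $ Inl a $ Inr l = 0"
  "collision_matrix lam s E $ Inr k $ Inl b = s k * equilibrium_matrix lam E $ k $ b"
  "collision_matrix lam s E $ Inr k $ Inr l = (if k = l then 1 - s k else 0)"
  by (simp_all add: collision_matrix_def relaxation_matrix_def matrix_matrix_mult_def
      mat_def if_distrib[of "\<lambda>x. x * _"] sum.delta cong: if_cong)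

lemma collision_mult:
  fixes P :: "diffop^3^moment"
  shows "(op_matrix (collision_matrix lam s E) ** P) $ Inl a $ j = P $ Inl a $ j"
   "(op_matrix (collision_matrix lam s E) ** P) $ Inr k $ j
      = scalar_op (s k) * (\<Sum>b\<in>UNIV. scalar_op (equilibrium_matrix lam E $ k $ b) * P $ Inl b $ j)
        + scalar_op (1 - s k) * P $ Inr k $ j"
  by (simp_all add: matrix_matrix_mult_def sum_moment collision_matrix_nth mat_def
      if_distrib[of scalar_op] if_distrib[of "\<lambda>x. x * _"] sum.delta scalar_op_mult
      sum_distrib_left mult.assoc cong: if_cong)

definition step_matrix :: "real \<Rightarrow> (nonconserved \<Rightarrow> real) \<Rightarrow> real^3^nonconserved
    \<Rightarrow> diffop fps^moment^moment" where
  "step_matrix lam s E = real_matrix (moment_matrix lam) ** exp_mdt (advection_matrix lam)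
         ** real_matrix (matrix_inv (moment_matrix lam))
         ** real_matrix (collision_matrix lam s E)"

lemma formal_expansion_step:
  "formal_expansion lam s E Psi A \<longleftrightarrow>
     (\<forall>i j. Psi $ Inl i $ j = mat 1 $ i $ j) \<and> step_matrix lam s E ** Psi = Psi ** exp_mdt A"
  by (simp add: formal_expansion_def step_matrix_def)

text \<open>The matrix D of the overview, with differential operators as entries.\<close>

definition moment_advection :: "real \<Rightarrow> diffop^moment^moment" where
  "moment_advection lam = op_matrix (moment_matrix lam) ** coeff_matrix (advection_matrix lam) 0
      ** op_matrix (matrix_inv (moment_matrix lam))"

context
  fixes lam :: real and s :: "nonconserved \<Rightarrow> real" and E :: "real^3^nonconserved"
  assumes inv: "moment_matrix lam ** matrix_inv (moment_matrix lam) = mat 1"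
    "matrix_inv (moment_matrix lam) ** moment_matrix lam = mat 1"
    and s: "\<And>k. s k \<noteq> 0"
begin

text \<open>These are the coefficients of exp (- \<Delta>t D) J: conjugation by M passes through the
  powers of the advection matrix. Invertibility of M is a hypothesis here and is supplied by
  \<open>moment_matrix_inverse\<close>.\<close>

lemma coeff_step_matrix:
  "coeff_matrix (step_matrix lam s E) 0 = op_matrix (collision_matrix lam s E)"
  "coeff_matrix (step_matrix lam s E) (Suc 0)
     = - (moment_advection lam ** op_matrix (collision_matrix lam s E))"
  "coeff_matrix (step_matrix lam s E) 2 = map_matrix ((*) (scalar_op (1/2)))
     (moment_advection lam ** moment_advection lam ** op_matrix (collision_matrix lam s E))"
proof -
  let ?L = "coeff_matrix (advection_matrix lam) 0"
  let ?M = "op_matrix (moment_matrix lam)" and ?N = "op_matrix (matrix_inv (moment_matrix lam))"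
  have MN: "?M ** ?N = mat 1" "?N ** ?M = mat 1"
    by (simp_all add: op_matrix_mult[symmetric] inv op_matrix_1)
  have DD: "moment_advection lam ** moment_advection lam = ?M ** (?L ** ?L) ** ?N"
    unfolding moment_advection_def by (metis (no_types) MN(2) matrix_mul_assoc matrix_mul_rid)
  \<comment> \<open>The advection matrix is constant in \<Delta>t, so the second-order coefficient
    of its exponential has only the quadratic term.\<close>
  have L1: "coeff_matrix (advection_matrix lam) (Suc 0) = 0"
    by (simp add: vec_eq_iff advection_matrix_def)
  show "coeff_matrix (step_matrix lam s E) 0 = op_matrix (collision_matrix lam s E)"
    "coeff_matrix (step_matrix lam s E) (Suc 0)
       = - (moment_advection lam ** op_matrix (collision_matrix lam s E))"
    by (simp_all add: step_matrix_def coeff_real_matrix_mult coeff_exp_mdt MN moment_advection_def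
        matrix_minus_mult matrix_mult_minus)
  show "coeff_matrix (step_matrix lam s E) 2 = map_matrix ((*) (scalar_op (1/2)))
     (moment_advection lam ** moment_advection lam ** op_matrix (collision_matrix lam s E))"
    unfolding DD
    by (simp add: step_matrix_def coeff_real_matrix_mult coeff_exp_mdt L1 map_matrix_scale_mult)
qed

text \<open>Write the step matrix as \<open>J + \<Delta>t H\<close>. The nonconserved rows of
  \<open>(J + \<Delta>t H) \<Psi> = \<Psi> X\<close>, with \<open>X\<close> read off from the conserved rows, become
  \<open>S Y = S E + \<Delta>t (\<dots>)\<close>; dividing by \<open>S\<close> gives the fixed-point equation of the following map.\<close>

definition "riccati Y = (\<chi> k j. fps_const (scalar_op (equilibrium_matrix lam E $ k $ j))
   + fps_X * (fps_const (scalar_op (1 / s k))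
       * ((map_matrix (fps_shift 1) (step_matrix lam s E) ** stack Y) $ Inr k $ j
          - (Y ** upper (map_matrix (fps_shift 1) (step_matrix lam s E) ** stack Y)) $ k $ j)))"

lemma agree_stack: "agree n A B \<Longrightarrow> agree n (stack A) (stack B)"
  by (auto simp: agree_def vec_eq_iff stack_def split: sum.split)

lemma agree_upper: "agree n A B \<Longrightarrow> agree n (upper A) (upper B)"
  by (auto simp: agree_def vec_eq_iff)

text \<open>Every occurrence of \<open>Y\<close> in \<open>riccati Y\<close> stands behind a factor
  \<open>fps_X\<close>, which gains one order of agreement.\<close>

lemma riccati_contraction:
  assumes "agree n A B" shows "agree (Suc n) (riccati A) (riccati B)"
proof -
  let ?H = "map_matrix (fps_shift 1) (step_matrix lam s E)"
  have 1: "agree n (?H ** stack A) (?H ** stack B)"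
    using assms by (intro agree_mult agree_stack) (simp_all add: agree_def)
  have 2: "agree n (A ** upper (?H ** stack A)) (B ** upper (?H ** stack B))"
    by (intro agree_mult[OF assms] agree_upper 1)
  have "fps_nth (riccati A $ k $ j) m = fps_nth (riccati B $ k $ j) m" if "m < Suc n" for m k j
  proof (cases m)
    case (Suc l)
    with that have "coeff_matrix (?H ** stack A) l = coeff_matrix (?H ** stack B) l"
      "coeff_matrix (A ** upper (?H ** stack A)) l = coeff_matrix (B ** upper (?H ** stack B)) l"
      using 1 2 by (simp_all add: agree_def)
    then have "fps_nth ((?H ** stack A) $ Inr k $ j) l = fps_nth ((?H ** stack B) $ Inr k $ j) l"
      "fps_nth ((A ** upper (?H ** stack A)) $ k $ j) l = fps_nth ((B ** upper (?H ** stack B)) $ k $ j) l"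
      by (simp_all only: coeff_matrix_nth[symmetric])
    then show ?thesis by (simp add: riccati_def Suc)
  qed (simp add: riccati_def)
  then show ?thesis by (auto simp: agree_def vec_eq_iff)
qed

lemma step_matrix_stack:
  fixes Y
  defines "HP \<equiv> map_matrix (fps_shift 1) (step_matrix lam s E) ** stack Y"
  shows "(step_matrix lam s E ** stack Y) $ Inl a $ j = mat 1 $ a $ j + fps_X * HP $ Inl a $ j"
    "(step_matrix lam s E ** stack Y) $ Inr k $ j
      = fps_const (scalar_op (s k)) * fps_const (scalar_op (equilibrium_matrix lam E $ k $ j))
        + fps_const (scalar_op (1 - s k)) * Y $ k $ j + fps_X * HP $ Inr k $ j"
proof -
  let ?J = "collision_matrix lam s E"
  have G: "step_matrix lam s E $ i $ j = fps_const (scalar_op (?J $ i $ j))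
      + fps_X * fps_shift 1 (step_matrix lam s E $ i $ j)" for i j
  proof -
    have "fps_nth (step_matrix lam s E $ i $ j) 0 = scalar_op (?J $ i $ j)"
      using arg_cong[OF coeff_step_matrix(1), of "\<lambda>A. A $ i $ j"] by simp
    then show ?thesis by (intro fps_ext) (simp add: fps_X_mult_nth)
  qed
  have *: "(step_matrix lam s E ** stack Y) $ i $ j
     = (\<Sum>l\<in>UNIV. fps_const (scalar_op (?J $ i $ l)) * stack Y $ l $ j) + fps_X * HP $ i $ j" for i j
    unfolding matrix_matrix_mult_def HP_def
    by (subst G) (simp add: distrib_right sum.distrib sum_distrib_left mult.assoc)
  show "(step_matrix lam s E ** stack Y) $ Inl a $ j = mat 1 $ a $ j + fps_X * HP $ Inl a $ j"
    unfolding * sum_moment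
    by (simp add: collision_matrix_nth mat_def if_distrib[of scalar_op] if_distrib[of fps_const]
       if_distrib[of "\<lambda>x. x * _"] sum.delta cong: if_cong)
  show "(step_matrix lam s E ** stack Y) $ Inr k $ j
      = fps_const (scalar_op (s k)) * fps_const (scalar_op (equilibrium_matrix lam E $ k $ j))
        + fps_const (scalar_op (1 - s k)) * Y $ k $ j + fps_X * HP $ Inr k $ j"
    unfolding * sum_moment
    by (simp add: collision_matrix_nth mat_def if_distrib[of scalar_op] if_distrib[of fps_const]
       if_distrib[of "\<lambda>x. x * _"] if_distrib[of "\<lambda>x. _ * x"] sum.delta scalar_op_mult cong: if_cong)
qed

text \<open>The conserved rows hold identically by the choice of \<open>upper\<close>, so only the
  nonconserved ones carry information.\<close>

lemma riccati_iff:
  "step_matrix lam s E ** stack Y = stack Y ** upper (step_matrix lam s E ** stack Y)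
    \<longleftrightarrow> riccati Y = Y"
proof -
  let ?HP = "map_matrix (fps_shift 1) (step_matrix lam s E) ** stack Y"
  have "(stack Y ** X) $ Inl a $ j = X $ a $ j" for X a j
    by (simp add: matrix_matrix_mult_def mat_def if_distrib[of "\<lambda>x. x * _"] sum.delta cong: if_cong)
  moreover have "(stack Y ** X) $ Inr k $ j = (Y ** X) $ k $ j" for X k j
    by (simp add: matrix_matrix_mult_def)
  ultimately have "step_matrix lam s E ** stack Y = stack Y ** upper (step_matrix lam s E ** stack Y)
     \<longleftrightarrow> (\<forall>k j. (step_matrix lam s E ** stack Y) $ Inr k $ j
             = (Y ** upper (step_matrix lam s E ** stack Y)) $ k $ j)"
    by (metis matrix_eqI_moment upper_nth)
  also have "\<dots> \<longleftrightarrow> (\<forall>k j. riccati Y $ k $ j = Y $ k $ j)"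
  proof -
    have YU: "(Y ** upper (step_matrix lam s E ** stack Y)) $ k $ j
        = Y $ k $ j + fps_X * (Y ** upper ?HP) $ k $ j" for k j
      by (simp add: matrix_matrix_mult_def[of Y] step_matrix_stack distrib_left sum.distrib
          sum_distrib_left mat_def if_distrib[of "\<lambda>x. _ * x"] sum.delta mult.left_commute cong: if_cong)
    have "((step_matrix lam s E ** stack Y) $ Inr k $ j
             = (Y ** upper (step_matrix lam s E ** stack Y)) $ k $ j) \<longleftrightarrow> riccati Y $ k $ j = Y $ k $ j"
      for k j
    proof -
      \<comment> \<open>\<open>diffop fps\<close> is not a field: dividing by \<open>s k\<close>
        means multiplying by the constant series \<open>c\<close>, which is inverse to
        \<open>S\<close>.\<close>
      define S where "S = fps_const (scalar_op (s k))"
      define c where "c = fps_const (scalar_op (1 / s k))"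
      have cS: "c * S = 1" using s[of k]
        by (simp add: c_def S_def scalar_op_mult[symmetric])
      have S1: "fps_const (scalar_op (1 - s k)) = 1 - S"
        by (simp add: S_def scalar_op_diff fps_const_sub[symmetric] del: fps_const_sub)
      let ?e = "fps_const (scalar_op (equilibrium_matrix lam E $ k $ j))"
      define R where "R = S * ?e + fps_X * (?HP $ Inr k $ j - (Y ** upper ?HP) $ k $ j) - S * Y $ k $ j"
      have "((step_matrix lam s E ** stack Y) $ Inr k $ j
             = (Y ** upper (step_matrix lam s E ** stack Y)) $ k $ j) \<longleftrightarrow> R = 0"
        unfolding YU step_matrix_stack S1 unfolding S_def[symmetric] R_def by (auto simp: algebra_simps)
      also have "\<dots> \<longleftrightarrow> c * R = 0"
      proof
        assume "c * R = 0"
        then have "S * (c * R) = 0" by simp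
        also have "S * (c * R) = c * S * R" by (simp only: mult_ac)
        finally show "R = 0" by (simp add: cS)
      qed simp
      also have "c * R = (c * S) * ?e + fps_X * (c * (?HP $ Inr k $ j - (Y ** upper ?HP) $ k $ j))
          - (c * S) * Y $ k $ j"
        unfolding R_def by (simp add: algebra_simps)
      also have "\<dots> = riccati Y $ k $ j - Y $ k $ j"
        unfolding cS by (simp add: riccati_def c_def)
      finally show ?thesis by simp
    qed
    then show ?thesis by blast
  qed
  finally show ?thesis by (simp add: vec_eq_iff)
qed

text \<open>Makes the description in \<open>equivalent_operator\<close> meaningful:
  \<open>Psi\<close> must be the stacked Riccati solution, and then \<open>exp_mdt A\<close> is its
  image under one step, restricted to the conserved rows.\<close>

lemma equivalent_operator_unique: "\<exists>!A. \<exists>Psi. formal_expansion lam s E Psi A"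
proof -
  obtain Y where Y: "riccati Y = Y" and Y': "\<And>Z. riccati Z = Z \<Longrightarrow> Z = Y"
    using fps_matrix_fixpoint[of riccati] riccati_contraction by metis
  have iff: "formal_expansion lam s E Psi A
      \<longleftrightarrow> Psi = stack Y \<and> exp_mdt A = upper (step_matrix lam s E ** stack Y)" for Psi A
  proof
    assume *: "formal_expansion lam s E Psi A"
    define Z :: "diffop fps^3^nonconserved" where "Z = (\<chi> k j. Psi $ Inr k $ j)"
    have Psi: "Psi = stack Z"
      using * by (intro matrix_eqI_moment) (simp_all add: formal_expansion_step Z_def)
    have eq: "step_matrix lam s E ** stack Z = stack Z ** exp_mdt A"
      using * by (simp add: formal_expansion_step Psi)
    have "exp_mdt A = upper (stack Z ** exp_mdt A)"
      by (simp add: vec_eq_iff matrix_matrix_mult_def mat_def if_distrib[of "\<lambda>x. x * _"] sum.delta cong: if_cong)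
    with eq have X: "exp_mdt A = upper (step_matrix lam s E ** stack Z)" by simp
    with eq have "riccati Z = Z" by (simp add: riccati_iff[symmetric])
    with Y' Psi X show "Psi = stack Y \<and> exp_mdt A = upper (step_matrix lam s E ** stack Y)" by auto
  next
    assume *: "Psi = stack Y \<and> exp_mdt A = upper (step_matrix lam s E ** stack Y)"
    with Y show "formal_expansion lam s E Psi A"
      by (simp add: formal_expansion_step riccati_iff)
  qed
  have "coeff_matrix (upper (step_matrix lam s E ** stack Y)) 0 = mat 1"
    by (simp add: vec_eq_iff step_matrix_stack mat_def)
  from exp_mdt_bij[OF this] show ?thesis by (simp add: iff)
qed

end

section \<open>The tensors of order one and two\<close>

text \<open>The real coefficient of \<partial>_\<alpha> in D, see
  \<open>moment_advection_nth\<close>.\<close>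

definition dir_advection :: "real \<Rightarrow> 2 \<Rightarrow> real^moment^moment" where
  "dir_advection lam \<alpha> = moment_matrix lam ** (\<chi> i j. if i = j then velocity lam j $ \<alpha> else 0)
     ** matrix_inv (moment_matrix lam)"

text \<open>The symbol of the coefficient of \<Delta>t^0 in \<Psi>.\<close>

definition equilibrium_moments :: "real \<Rightarrow> real^3^nonconserved \<Rightarrow> real^3^moment" where
  "equilibrium_moments lam E = stack (equilibrium_matrix lam E)"

definition first_tensor :: "real \<Rightarrow> real^3^nonconserved \<Rightarrow> 2 \<Rightarrow> real^3^3" where
  "first_tensor lam E \<alpha> = upper (dir_advection lam \<alpha> ** equilibrium_moments lam E)"

text \<open>The nonconserved rows of this tensor are the symbol of \<open>S \<Psi>\<^sub>1\<close>, where \<open>\<Psi>\<^sub>1\<close> is the coefficient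
  of \<open>\<Delta>t\<close> in \<open>\<Psi>\<close>.\<close>

definition defect :: "real \<Rightarrow> real^3^nonconserved \<Rightarrow> 2 \<Rightarrow> real^3^moment" where
  "defect lam E \<beta> = equilibrium_moments lam E ** first_tensor lam E \<beta>
     - dir_advection lam \<beta> ** equilibrium_moments lam E"

text \<open>Here \<alpha> comes from the block b and \<beta> from the defect, so this need not be
  symmetric in \<alpha> and \<beta>; only its symmetrization is determined by the operator.\<close>

definition second_tensor ::
  "real \<Rightarrow> (nonconserved \<Rightarrow> real) \<Rightarrow> real^3^nonconserved \<Rightarrow> 2 \<Rightarrow> 2 \<Rightarrow> real^3^3" where
  "second_tensor lam s E \<alpha> \<beta> = (\<chi> i j. \<Sum>k\<in>UNIV.
      dir_advection lam \<alpha> $ Inl i $ Inr k * relax_sigma s k * defect lam E \<beta> $ Inr k $ j)"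

lemma op_matrix_sum_mult:
  fixes A :: "diffop^'n^'m" and B :: "real^'k^'n"
  assumes "\<And>i j. A $ i $ j = (\<Sum>\<alpha>\<in>UNIV. partial_op \<alpha> * scalar_op (a \<alpha> $ i $ j))"
  shows "(A ** op_matrix B) $ i $ j = (\<Sum>\<alpha>\<in>UNIV. partial_op \<alpha> * scalar_op ((a \<alpha> ** B) $ i $ j))"
proof -
  have "(A ** op_matrix B) $ i $ j
      = (\<Sum>k\<in>UNIV. \<Sum>\<alpha>\<in>UNIV. partial_op \<alpha> * scalar_op (a \<alpha> $ i $ k * B $ k $ j))"
    by (simp add: matrix_matrix_mult_def assms sum_distrib_right scalar_op_mult mult.assoc)
  also have "\<dots> = (\<Sum>\<alpha>\<in>UNIV. \<Sum>k\<in>UNIV. partial_op \<alpha> * scalar_op (a \<alpha> $ i $ k * B $ k $ j))"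
    by (rule sum.swap)
  finally show ?thesis
    by (simp add: matrix_matrix_mult_def scalar_op_sum sum_distrib_left)
qed

lemma op_matrix_mult_sum:
  fixes A :: "diffop^'n^'m" and B :: "real^'m^'k"
  assumes "\<And>i j. A $ i $ j = (\<Sum>\<alpha>\<in>UNIV. partial_op \<alpha> * scalar_op (a \<alpha> $ i $ j))"
  shows "(op_matrix B ** A) $ i $ j = (\<Sum>\<alpha>\<in>UNIV. partial_op \<alpha> * scalar_op ((B ** a \<alpha>) $ i $ j))"
proof -
  have "(op_matrix B ** A) $ i $ j
      = (\<Sum>k\<in>UNIV. \<Sum>\<alpha>\<in>UNIV. partial_op \<alpha> * scalar_op (B $ i $ k * a \<alpha> $ k $ j))"
    by (simp add: matrix_matrix_mult_def assms sum_distrib_left scalar_op_mult mult_ac)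
  also have "\<dots> = (\<Sum>\<alpha>\<in>UNIV. \<Sum>k\<in>UNIV. partial_op \<alpha> * scalar_op (B $ i $ k * a \<alpha> $ k $ j))"
    by (rule sum.swap)
  finally show ?thesis
    by (simp add: matrix_matrix_mult_def scalar_op_sum sum_distrib_left)
qed

lemma moment_advection_nth:
  "moment_advection lam $ i $ j
    = (\<Sum>\<alpha>\<in>UNIV. partial_op \<alpha> * scalar_op (dir_advection lam \<alpha> $ i $ j))"
proof -
  have L: "coeff_matrix (advection_matrix lam) 0 $ i $ j = (\<Sum>\<alpha>\<in>UNIV. partial_op \<alpha>
      * scalar_op ((\<chi> i j. if i = j then velocity lam j $ \<alpha> else 0) $ i $ j))" for i j
    by (simp add: advection_matrix_def mult.commute)
  show ?thesis unfolding moment_advection_def dir_advection_def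
    by (intro op_matrix_sum_mult op_matrix_mult_sum L)
qed

lemma lists_length_2: "{\<alpha>s::2 list. length \<alpha>s = Suc 0} = {[1], [2]}"
  "{\<alpha>s::2 list. length \<alpha>s = 2} = {[1,1], [1,2], [2,1], [2,2]}"
  using exhaust_2 by (auto simp: length_Suc_conv numeral_2_eq_2)

context
  fixes lam :: real and s :: "nonconserved \<Rightarrow> real" and E :: "real^3^nonconserved"
  assumes inv: "moment_matrix lam ** matrix_inv (moment_matrix lam) = mat 1"
    "matrix_inv (moment_matrix lam) ** moment_matrix lam = mat 1"
    and s: "\<And>k. s k \<noteq> 0"
begin

text \<open>Nonconserved rows at order \<Delta>t^n give coefficient n of \<open>Psi\<close>,
  conserved rows at order \<Delta>t^(n+1) give coefficient n of \<open>A\<close>. Hence orders 0, 1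
  and 2 suffice.\<close>

lemma formal_expansion_coeffs:
  assumes "formal_expansion lam s E Psi A"
  shows "coeff_matrix A 0 $ i $ j
      = (\<Sum>\<alpha>\<in>UNIV. partial_op \<alpha> * scalar_op (first_tensor lam E \<alpha> $ i $ j))"
    and "coeff_matrix A (Suc 0) $ i $ j
      = (\<Sum>\<alpha>\<in>UNIV. \<Sum>\<beta>\<in>UNIV. partial_op \<alpha> * partial_op \<beta> * scalar_op (second_tensor lam s E \<alpha> \<beta> $ i $ j))"
proof -
  let ?J = "op_matrix (collision_matrix lam s E)" and ?D = "moment_advection lam"
  let ?A0 = "coeff_matrix A 0" and ?A1 = "coeff_matrix A (Suc 0)"
  let ?P0 = "coeff_matrix Psi 0" and ?P1 = "coeff_matrix Psi (Suc 0)" and ?P2 = "coeff_matrix Psi 2"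
  have sets: "{..0} = {0::nat}" "{..Suc 0} = {0, Suc 0}" "{..2} = {0, Suc 0, 2::nat}" by auto
  have top: "\<And>i j. Psi $ Inl i $ j = mat 1 $ i $ j"
    and eq: "step_matrix lam s E ** Psi = Psi ** exp_mdt A"
    using assms by (simp_all add: formal_expansion_step)
  have eqn: "coeff_matrix (step_matrix lam s E ** Psi) n = coeff_matrix (Psi ** exp_mdt A) n" for n
    by (simp add: eq)
  have e0: "?J ** ?P0 = ?P0"
    using eqn[of 0] by (simp add: coeff_matrix_mult coeff_step_matrix[OF inv s] coeff_exp_mdt sets)
  have e1: "?J ** ?P1 - ?D ** ?P0 = ?P1 - ?P0 ** ?A0"
    using eqn[of "Suc 0"]
    by (simp add: coeff_matrix_mult coeff_step_matrix[OF inv s] coeff_exp_mdt sets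
        matrix_minus_mult matrix_mult_minus matrix_mul_assoc[symmetric] e0)
  have e2: "?J ** ?P2 - ?D ** (?J ** ?P1) + map_matrix ((*) (scalar_op (1/2))) (?D ** (?D ** ?P0))
      = ?P2 - ?P1 ** ?A0 + (map_matrix ((*) (scalar_op (1/2))) (?P0 ** (?A0 ** ?A0)) - ?P0 ** ?A1)"
    using eqn[of 2]
    by (simp add: coeff_matrix_mult coeff_step_matrix[OF inv s] coeff_exp_mdt sets
        matrix_minus_mult matrix_mult_minus matrix_mul_assoc[symmetric] e0 map_matrix_scale_mult
        matrix_diff_ldistrib algebra_simps)
  have top0: "?P0 $ Inl i $ j = mat 1 $ i $ j" "?P1 $ Inl i $ j = 0" "?P2 $ Inl i $ j = 0" for i j
    by (simp_all add: top mat_def)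
  have P0: "?P0 = op_matrix (equilibrium_moments lam E)"
  proof (rule matrix_eqI_moment)
    show "?P0 $ Inl a $ j = op_matrix (equilibrium_moments lam E) $ Inl a $ j" for a j
      by (simp only: top0) (simp add: equilibrium_moments_def mat_def)
    fix k j
    have "?P0 $ Inr k $ j = scalar_op (s k) * scalar_op (equilibrium_matrix lam E $ k $ j)
       + scalar_op (1 - s k) * ?P0 $ Inr k $ j"
      using arg_cong[OF e0, of "\<lambda>A. A $ Inr k $ j"]
      by (simp only: collision_mult top0) (simp add: mat_def if_distrib[of "\<lambda>x. _ * x"] sum.delta cong: if_cong)
    moreover have "scalar_op (s k) \<noteq> 0" using s[of k] by (simp add: scalar_op_def)
    ultimately show "?P0 $ Inr k $ j = op_matrix (equilibrium_moments lam E) $ Inr k $ j"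
      by (simp add: scalar_op_diff equilibrium_moments_def algebra_simps)
  qed
  have P0_top: "(?P0 ** X) $ Inl i $ j = X $ i $ j" for X :: "diffop^3^3" and i j
    unfolding P0 by (simp add: equilibrium_moments_def matrix_matrix_mult_def mat_def
        if_distrib[of scalar_op] if_distrib[of "\<lambda>x. x * _"] sum.delta cong: if_cong)
  have A0: "?A0 $ i $ j = (?D ** ?P0) $ Inl i $ j" for i j
    using arg_cong[OF e1, of "\<lambda>A. A $ Inl i $ j"]
    by (simp only: vector_minus_component collision_mult top0 P0_top)
  have A0_sum: "?A0 $ i $ j
      = (\<Sum>\<alpha>\<in>UNIV. partial_op \<alpha> * scalar_op (first_tensor lam E \<alpha> $ i $ j))" for i j
    unfolding A0 P0 first_tensor_def upper_nth
    by (intro op_matrix_sum_mult moment_advection_nth)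
  show "?A0 $ i $ j = (\<Sum>\<alpha>\<in>UNIV. partial_op \<alpha> * scalar_op (first_tensor lam E \<alpha> $ i $ j))"
    by (rule A0_sum)
  define T where "T = ?P0 ** ?A0 - ?D ** ?P0"
  have T_top: "T $ Inl i $ j = 0" for i j
    by (simp only: T_def vector_minus_component P0_top A0)
  have JP1: "?J ** ?P1 = ?P1 - T" using e1 by (simp add: T_def algebra_simps)
  have T_bot: "T $ Inr k $ j = scalar_op (s k) * ?P1 $ Inr k $ j" for k j
    using arg_cong[OF JP1, of "\<lambda>A. A $ Inr k $ j"]
    by (simp only: vector_minus_component collision_mult top0) (simp add: scalar_op_diff algebra_simps)
  have DP0: "?D ** ?P0 = ?P0 ** ?A0 - T" by (simp add: T_def)
  have T_sum: "T $ i $ j = (\<Sum>\<beta>\<in>UNIV. partial_op \<beta> * scalar_op (defect lam E \<beta> $ i $ j))" for i j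
  proof -
    have "(?P0 ** ?A0) $ i $ j = (\<Sum>\<beta>\<in>UNIV. partial_op \<beta>
        * scalar_op ((equilibrium_moments lam E ** first_tensor lam E \<beta>) $ i $ j))"
      unfolding P0 by (intro op_matrix_mult_sum A0_sum)
    moreover have "(?D ** ?P0) $ i $ j = (\<Sum>\<beta>\<in>UNIV. partial_op \<beta>
        * scalar_op ((dir_advection lam \<beta> ** equilibrium_moments lam E) $ i $ j))"
      unfolding P0 by (intro op_matrix_sum_mult moment_advection_nth)
    ultimately show ?thesis
      by (simp only: T_def vector_minus_component defect_def scalar_op_diff right_diff_distrib sum_subtractf)
  qed
  have half: "scalar_op (1/2) * x + scalar_op (1/2) * x = x" for x
    by (simp only: distrib_right[symmetric] scalar_op_add[symmetric]) simp
  \<comment> \<open>Origin of 1/s - 1/2: in the conserved rows D D P0 is A0 A0 - D T, so the two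
    quadratic halves leave - 1/2 D T after the first-order terms are collected, while P1 is T / s in
    the nonconserved rows.\<close>
  have A1: "?A1 $ i $ j = (?D ** (?P1 - map_matrix ((*) (scalar_op (1/2))) T)) $ Inl i $ j"
  proof -
    have D2: "(?D ** (?D ** ?P0)) $ Inl i $ j = (?A0 ** ?A0) $ i $ j - (?D ** T) $ Inl i $ j"
    proof -
      have "?D ** (?D ** ?P0) = (?D ** ?P0) ** ?A0 - ?D ** T"
        by (simp only: DP0 matrix_diff_ldistrib matrix_mul_assoc)
      moreover have "((?D ** ?P0) ** ?A0) $ Inl i $ j = (?A0 ** ?A0) $ i $ j"
        by (simp add: matrix_matrix_mult_def[of _ ?A0] A0[symmetric])
      ultimately show ?thesis by (simp only: vector_minus_component)
    qed
    have P1_A: "(?P1 ** ?A0) $ Inl i $ j = 0"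
      by (simp only: matrix_matrix_mult_def vec_lambda_beta top0) simp
    define h where "h = scalar_op (1/2)"
    have h2: "h * x + h * x = x" for x unfolding h_def by (rule half)
    have "- ((?D ** ?P1) $ Inl i $ j - (?D ** T) $ Inl i $ j)
       + h * ((?A0 ** ?A0) $ i $ j - (?D ** T) $ Inl i $ j)
      = h * (?A0 ** ?A0) $ i $ j - ?A1 $ i $ j"
      using arg_cong[OF e2, of "\<lambda>A. A $ Inl i $ j"] unfolding h_def[symmetric]
      by (simp only: vector_minus_component vector_add_component nth_map_matrix collision_mult top0
          P0_top JP1 matrix_diff_ldistrib D2 P1_A)
    then have "?A1 $ i $ j = (?D ** ?P1) $ Inl i $ j - (?D ** T) $ Inl i $ j + h * (?D ** T) $ Inl i $ j"
      by (simp add: algebra_simps)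
    also have "\<dots> = (?D ** ?P1) $ Inl i $ j - h * (?D ** T) $ Inl i $ j"
      using h2[of "(?D ** T) $ Inl i $ j"] by (simp add: algebra_simps)
    finally show ?thesis
      by (simp only: matrix_diff_ldistrib map_matrix_scale_mult vector_minus_component nth_map_matrix h_def)
  qed
  also have "\<dots> = (\<Sum>k\<in>UNIV. ?D $ Inl i $ Inr k * (scalar_op (relax_sigma s k) * T $ Inr k $ j))"
  proof -
    have "?P1 $ Inr k $ j = scalar_op (1 / s k) * T $ Inr k $ j" for k
      using s[of k] unfolding T_bot by (simp add: mult.assoc[symmetric] scalar_op_mult[symmetric])
    then have "(?P1 - map_matrix ((*) (scalar_op (1/2))) T) $ Inr k $ j
        = scalar_op (relax_sigma s k) * T $ Inr k $ j" for k
      by (simp only: vector_minus_component nth_map_matrix relax_sigma_def scalar_op_diff left_diff_distrib)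
    moreover have "(?P1 - map_matrix ((*) (scalar_op (1/2))) T) $ Inl a $ j = 0" for a
      by (simp only: vector_minus_component nth_map_matrix top0 T_top)
    ultimately show ?thesis
      by (simp only: matrix_matrix_mult_def vec_lambda_beta sum_moment) simp
  qed
  also have "\<dots>
     = (\<Sum>k\<in>UNIV. \<Sum>\<alpha>\<in>UNIV. \<Sum>\<beta>\<in>UNIV. partial_op \<alpha> * partial_op \<beta> *
         scalar_op (dir_advection lam \<alpha> $ Inl i $ Inr k * relax_sigma s k * defect lam E \<beta> $ Inr k $ j))"
    by (rule sum.cong[OF refl]) (simp add: moment_advection_nth T_sum sum_2 scalar_op_mult algebra_simps)
  also have "\<dots> = (\<Sum>\<alpha>\<in>UNIV. \<Sum>\<beta>\<in>UNIV. \<Sum>k\<in>UNIV. partial_op \<alpha> * partial_op \<beta> *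
         scalar_op (dir_advection lam \<alpha> $ Inl i $ Inr k * relax_sigma s k * defect lam E \<beta> $ Inr k $ j))"
    by (subst sum.swap, rule sum.cong[OF refl], rule sum.swap)
  finally show "?A1 $ i $ j = (\<Sum>\<alpha>\<in>UNIV. \<Sum>\<beta>\<in>UNIV. partial_op \<alpha> * partial_op \<beta> * scalar_op (second_tensor lam s E \<alpha> \<beta> $ i $ j))"
    by (simp add: second_tensor_def scalar_op_sum sum_distrib_left)
qed

section \<open>Tensors read off from the operator\<close>

lemma equivalent_operator_expansion: "\<exists>Psi. formal_expansion lam s E Psi (equivalent_operator lam s E)"
  unfolding equivalent_operator_def by (rule theI'[OF equivalent_operator_unique[OF inv s]])

lemma equivalent_tensor_1:
  "equivalent_tensor lam s E (Suc 0)
     = (\<lambda>\<alpha>s. if length \<alpha>s = Suc 0 then first_tensor lam E (hd \<alpha>s) else 0)"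
  (is "_ = ?B")
proof -
  obtain Psi where Psi: "formal_expansion lam s E Psi (equivalent_operator lam s E)"
    using equivalent_operator_expansion by blast
  have nabla: "tensor_nabla (Suc 0) A $ i $ j = [:[:0, A [1] $ i $ j:], [:A [2] $ i $ j:]:]" for A i j
    by (simp add: tensor_nabla_def lists_length_2 partial_op_def scalar_op_def)
  have op: "fps_nth (equivalent_operator lam s E $ i $ j) 0
      = [:[:0, first_tensor lam E 1 $ i $ j:], [:first_tensor lam E 2 $ i $ j:]:]" for i j
    using formal_expansion_coeffs(1)[OF Psi, of i j]
    by (simp add: sum_2 partial_op_def scalar_op_def)
  have sym: "symmetric_tensor (Suc 0) ?B"
    unfolding symmetric_tensor_def
  proof (intro conjI allI impI)
    fix \<alpha>s \<beta>s :: "2 list" assume "mset \<alpha>s = mset \<beta>s"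
    then show "?B \<alpha>s = ?B \<beta>s"
      using mset_eq_length[of \<alpha>s \<beta>s] by (auto simp: length_Suc_conv)
  qed simp
  show ?thesis
    unfolding equivalent_tensor_def
  proof (rule the_equality)
    show "symmetric_tensor (Suc 0) ?B \<and>
      tensor_nabla (Suc 0) ?B = map_matrix (\<lambda>a. fps_nth a (Suc 0 - 1)) (equivalent_operator lam s E)"
      using sym by (simp add: vec_eq_iff nabla op)
  next
    fix A assume A: "symmetric_tensor (Suc 0) A \<and>
      tensor_nabla (Suc 0) A = map_matrix (\<lambda>a. fps_nth a (Suc 0 - 1)) (equivalent_operator lam s E)"
    then have "tensor_nabla (Suc 0) A $ i $ j = fps_nth (equivalent_operator lam s E $ i $ j) 0" for i j
      by simp
    then have *: "A [1] = first_tensor lam E 1" "A [2] = first_tensor lam E 2"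
      by (simp_all add: vec_eq_iff nabla op)
    show "A = ?B"
    proof
      fix \<alpha>s
      show "A \<alpha>s = ?B \<alpha>s"
      proof (cases "length \<alpha>s = Suc 0")
        case True
        then have "\<alpha>s \<in> {[1], [2]}" unfolding lists_length_2[symmetric] by simp
        with * show ?thesis by auto
      qed (use A in \<open>auto simp: symmetric_tensor_def\<close>)
    qed
  qed
qed

text \<open>The mixed polynomial coefficient fixes only the sum of the [1,2] and [2,1] components;
  symmetry splits it evenly.\<close>

lemma equivalent_tensor_2:
  "equivalent_tensor lam s E 2
     = (\<lambda>\<alpha>s. if length \<alpha>s = 2 then
          (1/2) *\<^sub>R (second_tensor lam s E (\<alpha>s ! 0) (\<alpha>s ! 1) + second_tensor lam s E (\<alpha>s ! 1) (\<alpha>s ! 0))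
        else 0)"
  (is "_ = ?B")
proof -
  let ?S = "second_tensor lam s E"
  obtain Psi where Psi: "formal_expansion lam s E Psi (equivalent_operator lam s E)"
    using equivalent_operator_expansion by blast
  have nabla: "tensor_nabla 2 A $ i $ j
     = [:[:0, 0, A [1,1] $ i $ j:], [:0, A [1,2] $ i $ j + A [2,1] $ i $ j:], [:A [2,2] $ i $ j:]:]" for A i j
    by (simp add: tensor_nabla_def lists_length_2 partial_op_def scalar_op_def)
  have op: "fps_nth (equivalent_operator lam s E $ i $ j) (Suc 0)
      = [:[:0, 0, ?S 1 1 $ i $ j:], [:0, ?S 1 2 $ i $ j + ?S 2 1 $ i $ j:], [:?S 2 2 $ i $ j:]:]" for i j
    using formal_expansion_coeffs(2)[OF Psi, of i j]
    by (simp add: sum_2 partial_op_def scalar_op_def)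
  have mset2: "A [1, 2] = A [2, 1]" if "symmetric_tensor 2 A" for A
  proof -
    have "mset [1, 2] = mset [2, 1 :: 2]" by simp
    then show ?thesis using that unfolding symmetric_tensor_def by blast
  qed
  have sym: "symmetric_tensor 2 ?B"
    unfolding symmetric_tensor_def
  proof (intro conjI allI impI)
    fix \<alpha>s \<beta>s :: "2 list" assume m: "mset \<alpha>s = mset \<beta>s"
    show "?B \<alpha>s = ?B \<beta>s"
    proof (cases "length \<alpha>s = 2")
      case True
      then have "length \<beta>s = 2" using mset_eq_length[OF m] by simp
      with True obtain a b c d where ab: "\<alpha>s = [a, b]" "\<beta>s = [c, d]"
        by (auto simp: numeral_2_eq_2 length_Suc_conv)
      have "c = a \<or> c = b" using arg_cong[OF m, of set_mset] by (auto simp: ab)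
      moreover have "b = d" if "c = a" using m that by (simp add: ab)
      moreover have "a = d" if "c = b" using m that by (simp add: ab add_mset_commute[of a b])
      ultimately show ?thesis by (auto simp: ab add.commute)
    qed (use mset_eq_length[OF m] in simp)
  qed simp
  show ?thesis
    unfolding equivalent_tensor_def
  proof (rule the_equality)
    show "symmetric_tensor 2 ?B \<and>
      tensor_nabla 2 ?B = map_matrix (\<lambda>a. fps_nth a (2 - 1)) (equivalent_operator lam s E)"
      using sym by (simp add: vec_eq_iff nabla op field_simps)
  next
    fix A assume A: "symmetric_tensor 2 A \<and>
      tensor_nabla 2 A = map_matrix (\<lambda>a. fps_nth a (2 - 1)) (equivalent_operator lam s E)"
    then have "tensor_nabla 2 A $ i $ j = fps_nth (equivalent_operator lam s E $ i $ j) (Suc 0)" for i j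
      by simp
    then have *: "A [1,1] $ i $ j = ?S 1 1 $ i $ j" "A [2,2] $ i $ j = ?S 2 2 $ i $ j"
      "A [1,2] $ i $ j + A [2,1] $ i $ j = ?S 1 2 $ i $ j + ?S 2 1 $ i $ j" for i j
      by (simp_all add: nabla op)
    show "A = ?B"
    proof
      fix \<alpha>s
      show "A \<alpha>s = ?B \<alpha>s"
      proof (cases "length \<alpha>s = 2")
        case True
        then have "\<alpha>s \<in> {[1,1], [1,2], [2,1], [2,2]}" unfolding lists_length_2[symmetric] by simp
        moreover have "A [1,2] = A [2,1]" using A mset2 by blast
        moreover have "A [2,1] $ i $ j = (?S 1 2 $ i $ j + ?S 2 1 $ i $ j) / 2" for i j
          using *(3)[of i j] \<open>A [1,2] = A [2,1]\<close> by simp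
        ultimately show ?thesis using * by (auto simp: vec_eq_iff add.commute)
      qed (use A in \<open>auto simp: symmetric_tensor_def\<close>)
    qed
  qed
qed

end

section \<open>The advection operator in the moment basis\<close>

fun moment_weight :: "moment \<Rightarrow> nat" where
  "moment_weight (Inl a) = (if a = 1 then 0 else 1)"
| "moment_weight (Inr k) = moment_degree k"

lemma norm_sq_2: "(norm v)\<^sup>2 = (v $ 1)\<^sup>2 + (v $ 2)\<^sup>2" for v :: "real^2"
  unfolding power2_norm_eq_inner by (simp add: inner_vec_def sum_2 power2_eq_square)

lemma norm_pow_2: "(norm v) ^ 4 = ((v $ 1)\<^sup>2 + (v $ 2)\<^sup>2)\<^sup>2"
  "(norm v) ^ 6 = ((v $ 1)\<^sup>2 + (v $ 2)\<^sup>2) ^ 3" for v :: "real^2"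
  unfolding norm_sq_2[symmetric] by (simp_all flip: power_mult)

text \<open>Each moment polynomial is homogeneous in \<open>v\<close> and \<open>lam\<close>
  jointly, so numerical checks reduce to \<open>lam = 1\<close>.\<close>

lemma moment_matrix_scaling:
  "moment_matrix lam $ i $ j = lam ^ moment_weight i * moment_matrix 1 $ i $ j"
proof (cases i)
  case (Inl a)
  then show ?thesis
    using exhaust_3[of a] by (auto simp: moment_matrix_def conserved_poly_def velocity_def)
next
  case (Inr k)
  then show ?thesis
    by (cases k) (simp_all add: moment_matrix_def velocity_def norm_sq_2 norm_pow_2 del: norm_scaleR,
        simp_all add: algebra_simps eval_nat_numeral)
qed

lemmas unit_moment_simps = moment_matrix_def velocity_def conserved_poly_def norm_sq_2 norm_pow_2

section \<open>Orthogonality of the moments and invertibility of M\<close>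

lemma sum_vel: "(\<Sum>j\<in>UNIV. f j) = f F0 + f F1 + f F2 + f F3 + f F4 + f F5 + f F6 + f F7 + f F8
   + f F9 + f F10 + f F11 + f F12"
  by (simp add: UNIV_vel add.assoc)

lemma sum_nonconserved: "(\<Sum>k\<in>UNIV. f k) = f Energy + f Phi_xx + f Phi_xy + f Phi_x + f Phi_y
   + f X_eps2 + f Y_eps2 + f Eps2 + f Eps3 + f XX_eps"
  by (simp add: UNIV_nonconserved add.assoc)

lemma unit_moments_orthogonal:
  assumes "i \<noteq> i'"
  shows "(\<Sum>j\<in>UNIV. moment_matrix 1 $ i $ j * moment_matrix 1 $ i' $ j) = 0"
proof -
  have 1: "(\<Sum>j\<in>UNIV. moment_matrix 1 $ Inl a $ j * moment_matrix 1 $ Inl a' $ j) = 0"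
    if "a \<noteq> a'" for a a'
    using that exhaust_3[of a] exhaust_3[of a'] by (auto simp: sum_vel unit_moment_simps)
  have 2: "(\<Sum>j\<in>UNIV. moment_matrix 1 $ Inl a $ j * moment_matrix 1 $ Inr k $ j) = 0" for a k
    using exhaust_3[of a] by (cases k; auto simp: sum_vel unit_moment_simps)
  have 3: "(\<Sum>j\<in>UNIV. moment_matrix 1 $ Inr k' $ j * moment_matrix 1 $ Inr k $ j) = 0"
    if "k \<noteq> k'" for k k'
    using that by (cases k; cases k'; simp add: sum_vel unit_moment_simps)
  show ?thesis
    using assms 1 2 3 by (cases i; cases i') (auto simp: mult.commute)
qed

lemma unit_moments_nonzero: "(\<Sum>j\<in>UNIV. moment_matrix 1 $ i $ j * moment_matrix 1 $ i $ j) \<noteq> 0"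
proof (cases i)
  case (Inl a)
  then show ?thesis
    using exhaust_3[of a] by (auto simp: sum_vel unit_moment_simps)
next
  case (Inr k)
  then show ?thesis
    by (cases k) (simp_all add: sum_vel unit_moment_simps)
qed

lemma moment_matrix_inverse:
  assumes "lam \<noteq> 0"
  shows "moment_matrix lam ** matrix_inv (moment_matrix lam) = mat 1"
    and "matrix_inv (moment_matrix lam) ** moment_matrix lam = mat 1"
proof -
  let ?M = "moment_matrix lam"
  define N where "N i = (\<Sum>j\<in>UNIV. moment_matrix 1 $ i $ j * moment_matrix 1 $ i $ j)" for i
  \<comment> \<open>The transpose with normalized columns: by orthogonality of the rows of M it is a
    right inverse.\<close>
  define B :: "real^moment^vel" where
    "B = (\<chi> j i. moment_matrix 1 $ i $ j / (lam ^ moment_weight i * N i))"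
  have MB: "?M ** B = mat 1"
  proof -
    have "(?M ** B) $ i $ i' = lam ^ moment_weight i / (lam ^ moment_weight i' * N i')
       * (\<Sum>j\<in>UNIV. moment_matrix 1 $ i $ j * moment_matrix 1 $ i' $ j)" for i i'
      by (simp add: matrix_matrix_mult_def B_def moment_matrix_scaling[of lam] sum_distrib_left mult_ac)
    moreover have "N i \<noteq> 0" for i using unit_moments_nonzero by (simp add: N_def)
    ultimately show ?thesis
      using assms unit_moments_orthogonal by (simp add: vec_eq_iff mat_def N_def)
  qed
  \<comment> \<open>\<open>moment\<close> and \<open>vel\<close> are different types with 13
    elements each, so two-sidedness comes from a dimension count: \<open>B\<close> is injective,
    hence surjective, and its right inverse must be M.\<close>
  have inj: "inj ((*v) B)"
    using MB by (intro injI) (metis matrix_vector_mul_assoc matrix_vector_mul_lid)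
  have "dim (range ((*v) B)) = dim (UNIV :: (real^moment) set)"
    using inj by (intro dim_image_eq) (auto simp: matrix_vector_mul_linear)
  also have "\<dots> = DIM(real^vel)"
    by (simp add: UNIV_vel UNIV_nonconserved card_UNIV_sum)
  finally have "span (range ((*v) B)) = UNIV" by (simp only: dim_eq_full)
  moreover have "subspace (range ((*v) B))"
    by (simp add: linear_subspace_image matrix_vector_mul_linear)
  ultimately have "surj ((*v) B)" by (metis span_eq_iff)
  then have "B ** ?M = mat 1"
    using MB by (metis matrix_left_right_inverse matrix_mul_assoc matrix_mul_lid matrix_right_invertible_surjective)
  with MB have "\<exists>B. ?M ** B = mat 1 \<and> B ** ?M = mat 1" by blast
  from someI_ex[OF this] show "?M ** matrix_inv ?M = mat 1" "matrix_inv ?M ** ?M = mat 1"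
    by (simp_all add: matrix_inv_def)
qed

text \<open>Row i of M \<Lambda> is the function v^\<alpha> p_i on the nodes. If it is a combination
  of rows of M, the coefficients are row i of D, because M M^-1 = 1.\<close>

lemma dir_advection_row:
  assumes lam: "lam \<noteq> 0"
    and row: "\<And>j. (\<Sum>(c, k)\<leftarrow>cs. c * moment_matrix lam $ k $ j) = moment_matrix lam $ i $ j * velocity lam j $ \<alpha>"
  shows "dir_advection lam \<alpha> $ i $ l = (\<Sum>(c, k)\<leftarrow>cs. if k = l then c else 0)"
proof -
  let ?M = "moment_matrix lam"
  have "(?M ** (\<chi> i j. if i = j then velocity lam j $ \<alpha> else 0)) $ i $ j
      = (\<Sum>(c, k)\<leftarrow>cs. c * ?M $ k $ j)" for j
    by (simp add: matrix_matrix_mult_def row if_distrib[of "\<lambda>x. _ * x"] sum.delta' cong: if_cong)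
  then have "dir_advection lam \<alpha> $ i $ l
      = (\<Sum>j\<in>UNIV. (\<Sum>(c, k)\<leftarrow>cs. c * ?M $ k $ j) * matrix_inv ?M $ j $ l)"
    unfolding dir_advection_def matrix_matrix_mult_def[of "_ ** _"] by simp
  also have "\<dots> = (\<Sum>(c, k)\<leftarrow>cs. c * (?M ** matrix_inv ?M) $ k $ l)"
    by (induction cs) (auto simp: matrix_matrix_mult_def distrib_right sum.distrib sum_distrib_left mult.assoc)
  finally show ?thesis
    by (simp add: moment_matrix_inverse[OF lam] mat_def if_distrib[of "\<lambda>x. _ * x"] cong: if_cong)
qed

text \<open>The rows of \<open>Phi_xx\<close> and \<open>Phi_xy\<close> rest on identities valid
  only on the nodes. For \<open>lam = 1\<close> and v^x nonzero, (v^x)^2 - (v^y)^2 takes the values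
  1, 0, 4 and (v^y)^2 the values 0, 1, 0 at |v|^2 = 1, 2, 4; interpolation by a quadratic in |v|^2
  brings in \<open>X_eps2\<close>, and likewise \<open>Y_eps2\<close>.\<close>

lemma dir_advection_rows:
  assumes "lam \<noteq> 0"
  shows "dir_advection lam 1 $ Inl 1 $ l = (\<Sum>(c, k)\<leftarrow>[(1, Inl 2)]. if k = l then c else 0)"
   "dir_advection lam 2 $ Inl 1 $ l = (\<Sum>(c, k)\<leftarrow>[(1, Inl 3)]. if k = l then c else 0)"
   "dir_advection lam 1 $ Inl 2 $ l = (\<Sum>(c, k)\<leftarrow>[(14/13 * lam^2, Inl 1), (1/26, Inr Energy), (1/2, Inr Phi_xx)]. if k = l then c else 0)"
   "dir_advection lam 2 $ Inl 2 $ l = (\<Sum>(c, k)\<leftarrow>[(1, Inr Phi_xy)]. if k = l then c else 0)"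
   "dir_advection lam 1 $ Inl 3 $ l = (\<Sum>(c, k)\<leftarrow>[(1, Inr Phi_xy)]. if k = l then c else 0)"
   "dir_advection lam 2 $ Inl 3 $ l = (\<Sum>(c, k)\<leftarrow>[(14/13 * lam^2, Inl 1), (1/26, Inr Energy), (-1/2, Inr Phi_xx)]. if k = l then c else 0)"
   "dir_advection lam 1 $ Inr Energy $ l = (\<Sum>(c, k)\<leftarrow>[(11 * lam^2, Inl 2), (13, Inr Phi_x)]. if k = l then c else 0)"
   "dir_advection lam 2 $ Inr Energy $ l = (\<Sum>(c, k)\<leftarrow>[(11 * lam^2, Inl 3), (13, Inr Phi_y)]. if k = l then c else 0)"
   "dir_advection lam 1 $ Inr Phi_xx $ l = (\<Sum>(c, k)\<leftarrow>[(17/7 * lam^2, Inl 2), (7/5, Inr Phi_x), (12/35 / lam^2, Inr X_eps2)]. if k = l then c else 0)"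
   "dir_advection lam 2 $ Inr Phi_xx $ l = (\<Sum>(c, k)\<leftarrow>[(- 17/7 * lam^2, Inl 3), (-7/5, Inr Phi_y), (- 12/35 / lam^2, Inr Y_eps2)]. if k = l then c else 0)"
   "dir_advection lam 1 $ Inr Phi_xy $ l = (\<Sum>(c, k)\<leftarrow>[(2/7 * lam^2, Inl 3), (-1/5, Inr Phi_y), (- 6/35 / lam^2, Inr Y_eps2)]. if k = l then c else 0)"
   "dir_advection lam 2 $ Inr Phi_xy $ l = (\<Sum>(c, k)\<leftarrow>[(2/7 * lam^2, Inl 2), (-1/5, Inr Phi_x), (- 6/35 / lam^2, Inr X_eps2)]. if k = l then c else 0)"
  by (rule dir_advection_row[OF assms], case_tac j;
      use assms in \<open>simp add: moment_matrix_scaling[of lam] unit_moment_simps field_simps; simp add: eval_nat_numeral\<close>)+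

section \<open>Isotropic tensors\<close>

text \<open>Cosine and sine stay algebraic, so invariance becomes a polynomial identity modulo c^2 +
  d^2 = 1.\<close>

definition rot :: "real \<Rightarrow> real \<Rightarrow> real^2^2" where
  "rot c d = vector [vector [c, - d], vector [d, c]]"

lemma rot_nth [simp]: "rot c d $ 1 $ 1 = c" "rot c d $ 1 $ 2 = - d" "rot c d $ 2 $ 1 = d" "rot c d $ 2 $ 2 = c"
  by (simp_all add: rot_def)

lemma rotation_matrix_rot: "c * c + d * d = 1 \<Longrightarrow> rotation_matrix (rot c d)"
  by (simp add: rotation_matrix_def orthogonal_matrix det_2 vec_eq_iff forall_2
      matrix_matrix_mult_def transpose_def sum_2 mat_def algebra_simps)

lemma rotation_matrix_2E:
  assumes "rotation_matrix (r :: real^2^2)"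
  obtains c d where "r = rot c d" "c * c + d * d = 1"
proof -
  have o: "transpose r ** r = mat 1" "r ** transpose r = mat 1" and d: "det r = 1"
    using assms by (simp_all add: rotation_matrix_def orthogonal_matrix_def)
  have 1: "r$1$1 * r$1$1 + r$2$1 * r$2$1 = 1" "r$1$2 * r$1$2 + r$2$2 * r$2$2 = 1"
    "r$1$1 * r$1$2 + r$2$1 * r$2$2 = 0"
    using arg_cong[OF o(1), of "\<lambda>A. A $ 1 $ 1"] arg_cong[OF o(1), of "\<lambda>A. A $ 2 $ 2"]
      arg_cong[OF o(1), of "\<lambda>A. A $ 1 $ 2"]
    by (simp_all add: matrix_matrix_mult_def transpose_def sum_2 mat_def)
  have 2: "r$1$1 * r$2$2 - r$1$2 * r$2$1 = 1" using d by (simp add: det_2)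
  \<comment> \<open>The left side is the squared Frobenius norm minus twice the determinant, that is
    2 - 2.\<close>
  have "(r$1$1 - r$2$2)\<^sup>2 + (r$1$2 + r$2$1)\<^sup>2 = 0"
    using 1 2 by (simp add: power2_eq_square algebra_simps)
  then have "r$1$1 = r$2$2" "r$1$2 = - r$2$1" by (simp_all add: sum_power2_eq_zero_iff)
  then have "r = rot (r$1$1) (r$2$1)" by (simp add: vec_eq_iff forall_2)
  with 1(1) that show ?thesis by blast
qed

lemma matrix_inv_eqI:
  assumes "A ** B = mat 1" "B ** A = mat 1"
  shows "matrix_inv A = (B :: real^'n^'m)"
proof -
  have "\<exists>B. A ** B = mat 1 \<and> B ** A = mat 1" using assms by blast
  from someI_ex[OF this] have "matrix_inv A ** A = mat 1" by (simp add: matrix_inv_def)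
  then show ?thesis by (metis assms(1) matrix_mul_assoc matrix_mul_lid matrix_mul_rid)
qed

lemma rotation_rep_nth [simp]:
  "rotation_rep r $ 1 $ 1 = 1" "rotation_rep r $ 1 $ 2 = 0" "rotation_rep r $ 1 $ 3 = 0"
  "rotation_rep r $ 2 $ 1 = 0" "rotation_rep r $ 2 $ 2 = r $ 1 $ 1" "rotation_rep r $ 2 $ 3 = r $ 1 $ 2"
  "rotation_rep r $ 3 $ 1 = 0" "rotation_rep r $ 3 $ 2 = r $ 2 $ 1" "rotation_rep r $ 3 $ 3 = r $ 2 $ 2"
  by (simp_all add: rotation_rep_def)

lemma matrix_inv_rotation_rep:
  assumes "c * c + d * d = 1"
  shows "matrix_inv (rotation_rep (rot c d)) = rotation_rep (rot c (- d))"
  using assms by (intro matrix_inv_eqI)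
    (simp_all add: vec_eq_iff forall_3 matrix_matrix_mult_def sum_3 mat_def algebra_simps)

lemma all_lists_length_2:
  "(\<forall>\<alpha>s::2 list. length \<alpha>s = Suc 0 \<longrightarrow> P \<alpha>s) \<longleftrightarrow> P [1] \<and> P [2]"
  "(\<forall>\<alpha>s::2 list. length \<alpha>s = 2 \<longrightarrow> P \<alpha>s) \<longleftrightarrow> P [1,1] \<and> P [1,2] \<and> P [2,1] \<and> P [2,2]"
proof -
  have "(\<forall>\<alpha>s::2 list. length \<alpha>s = n \<longrightarrow> P \<alpha>s) \<longleftrightarrow> (\<forall>\<alpha>s\<in>{\<alpha>s. length \<alpha>s = n}. P \<alpha>s)" for n by simp
  then show "(\<forall>\<alpha>s::2 list. length \<alpha>s = Suc 0 \<longrightarrow> P \<alpha>s) \<longleftrightarrow> P [1] \<and> P [2]"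
    "(\<forall>\<alpha>s::2 list. length \<alpha>s = 2 \<longrightarrow> P \<alpha>s) \<longleftrightarrow> P [1,1] \<and> P [1,2] \<and> P [2,1] \<and> P [2,2]"
    by (simp_all only: lists_length_2) simp_all
qed

lemma rotation_invariant_iff:
  "(\<forall>r. rotation_matrix r \<longrightarrow> (\<forall>\<alpha>s. length \<alpha>s = n \<longrightarrow> rotate_tensor n r A \<alpha>s = A \<alpha>s))
    \<longleftrightarrow> (\<forall>c d. c * c + d * d = 1 \<longrightarrow>
          (\<forall>\<alpha>s. length \<alpha>s = n \<longrightarrow> (\<forall>i j. rotate_tensor n (rot c d) A \<alpha>s $ i $ j = A \<alpha>s $ i $ j)))"
  by (simp add: vec_eq_iff) (metis rotation_matrix_2E rotation_matrix_rot)

lemma rotate_tensor_1: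
  assumes "c * c + d * d = 1"
  shows "rotate_tensor (Suc 0) (rot c d) A [a] $ i $ j
    = (\<Sum>b\<in>UNIV. rot c d $ a $ b * (\<Sum>l\<in>UNIV. rotation_rep (rot c d) $ i $ l *
        (\<Sum>k\<in>UNIV. A [b] $ l $ k * rotation_rep (rot c (- d)) $ k $ j)))"
  by (simp add: rotate_tensor_def lists_length_2 matrix_inv_rotation_rep[OF assms] sum_2 sum_3 algebra_simps)

lemma rotate_tensor_2:
  assumes "c * c + d * d = 1"
  shows "rotate_tensor 2 (rot c d) A [a, a'] $ i $ j
    = (\<Sum>b\<in>UNIV. \<Sum>b'\<in>UNIV. rot c d $ a $ b * rot c d $ a' $ b' * (\<Sum>l\<in>UNIV. rotation_rep (rot c d) $ i $ l *
        (\<Sum>k\<in>UNIV. A [b, b'] $ l $ k * rotation_rep (rot c (- d)) $ k $ j)))"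
proof -
  have "{..<2::nat} = {0, Suc 0}" by auto
  then show ?thesis
    by (simp add: rotate_tensor_def lists_length_2 matrix_inv_rotation_rep[OF assms] sum_2 sum_3 algebra_simps)
qed

text \<open>The half turn multiplies a component by -1 for each vector index, killing those with an
  odd number; the quarter turn relates the others. The converse shows that these two rotations
  already detect everything.\<close>

lemma rotation_invariant_1:
  "(\<forall>r. rotation_matrix r \<longrightarrow> (\<forall>\<alpha>s. length \<alpha>s = Suc 0 \<longrightarrow> rotate_tensor (Suc 0) r A \<alpha>s = A \<alpha>s))
   \<longleftrightarrow> A [1] $ 1 $ 1 = 0 \<and> A [2] $ 1 $ 1 = 0
     \<and> A [2] $ 1 $ 3 = A [1] $ 1 $ 2 \<and> A [2] $ 1 $ 2 = - A [1] $ 1 $ 3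
     \<and> A [2] $ 3 $ 1 = A [1] $ 2 $ 1 \<and> A [2] $ 2 $ 1 = - A [1] $ 3 $ 1
     \<and> A [1] $ 2 $ 2 = 0 \<and> A [1] $ 2 $ 3 = 0 \<and> A [1] $ 3 $ 2 = 0 \<and> A [1] $ 3 $ 3 = 0
     \<and> A [2] $ 2 $ 2 = 0 \<and> A [2] $ 2 $ 3 = 0 \<and> A [2] $ 3 $ 2 = 0 \<and> A [2] $ 3 $ 3 = 0"
  (is "?L \<longleftrightarrow> ?R")
proof
  assume ?L
  then have *: "rotate_tensor (Suc 0) (rot c d) A [a] $ i $ j = A [a] $ i $ j"
    if "c * c + d * d = 1" for c d a i j
    using that unfolding rotation_invariant_iff by simp
  have half: "- A [a] $ i $ j = A [a] $ i $ j" if "(i = 1 \<and> j = 1) \<or> (i \<noteq> 1 \<and> j \<noteq> 1)" for a i j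
    using *[of "-1" 0 a i j] that exhaust_2[of a] exhaust_3[of i] exhaust_3[of j]
    by (auto simp: rotate_tensor_1 sum_2 sum_3)
  have quarter: "rotate_tensor (Suc 0) (rot 0 1) A [a] $ i $ j = A [a] $ i $ j" for a i j
    by (rule *) simp
  show ?R
    using half[of 1 1 1] half[of 1 1 2] half[of 2 2 1] half[of 2 2 2] half[of 2 3 1] half[of 2 3 2]
     half[of 3 2 1] half[of 3 2 2] half[of 3 3 1] half[of 3 3 2]
     quarter[of 2 1 3] quarter[of 2 1 2] quarter[of 2 3 1] quarter[of 2 2 1]
    by (simp add: rotate_tensor_1 sum_2 sum_3)
next
  assume R: ?R
  show ?L
    unfolding rotation_invariant_iff unfolding all_lists_length_2
  proof (intro allI impI)
    fix c d :: real assume cd: "c * c + d * d = 1"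
    \<comment> \<open>Replacing d^2 by 1 - c^2 gives a normal form modulo the circle equation;
      \<open>ddx\<close> does this inside longer products.\<close>
    then have dd: "d * d = 1 - c * c" by simp
    have ddx: "d * (d * x) = x - c * (c * x)" for x
      using arg_cong[OF dd, of "\<lambda>y. y * x"] by (simp add: algebra_simps)
    show "(\<forall>i j. rotate_tensor (Suc 0) (rot c d) A [1] $ i $ j = A [1] $ i $ j)
      \<and> (\<forall>i j. rotate_tensor (Suc 0) (rot c d) A [2] $ i $ j = A [2] $ i $ j)"
      by (simp add: R rotate_tensor_1[OF cd] forall_3 sum_2 sum_3, (intro conjI)?; simp add: algebra_simps dd ddx)
  qed
qed


text \<open>With two spatial indices the parity is reversed: the half turn kills the components
  where exactly one of i, j is the density. The last two equations remove the harmonics of degree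
  4.\<close>

lemma rotation_invariant_2:
  assumes sym: "A [2, 1] = A [1, 2]"
  shows "(\<forall>r. rotation_matrix r \<longrightarrow> (\<forall>\<alpha>s. length \<alpha>s = 2 \<longrightarrow> rotate_tensor 2 r A \<alpha>s = A \<alpha>s))
   \<longleftrightarrow> A [2,2] $ 1 $ 1 = A [1,1] $ 1 $ 1 \<and> A [1,2] $ 1 $ 1 = 0
     \<and> A [1,1] $ 1 $ 2 = 0 \<and> A [1,1] $ 1 $ 3 = 0 \<and> A [1,2] $ 1 $ 2 = 0 \<and> A [1,2] $ 1 $ 3 = 0
     \<and> A [2,2] $ 1 $ 2 = 0 \<and> A [2,2] $ 1 $ 3 = 0
     \<and> A [1,1] $ 2 $ 1 = 0 \<and> A [1,1] $ 3 $ 1 = 0 \<and> A [1,2] $ 2 $ 1 = 0 \<and> A [1,2] $ 3 $ 1 = 0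
     \<and> A [2,2] $ 2 $ 1 = 0 \<and> A [2,2] $ 3 $ 1 = 0
     \<and> A [1,1] $ 3 $ 3 = A [2,2] $ 2 $ 2 \<and> A [2,2] $ 3 $ 3 = A [1,1] $ 2 $ 2
     \<and> A [1,1] $ 3 $ 2 = - A [2,2] $ 2 $ 3 \<and> A [2,2] $ 3 $ 2 = - A [1,1] $ 2 $ 3
     \<and> A [1,2] $ 3 $ 3 = - A [1,2] $ 2 $ 2 \<and> A [1,2] $ 3 $ 2 = A [1,2] $ 2 $ 3
     \<and> A [1,1] $ 2 $ 2 = A [2,2] $ 2 $ 2 + 2 * A [1,2] $ 2 $ 3
     \<and> A [1,1] $ 2 $ 3 = A [2,2] $ 2 $ 3 - 2 * A [1,2] $ 2 $ 2"
  (is "?L \<longleftrightarrow> ?R")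
proof
  assume ?L
  then have *: "rotate_tensor 2 (rot c d) A [a, b] $ i $ j = A [a, b] $ i $ j"
    if "c * c + d * d = 1" for c d a b i j
    using that unfolding rotation_invariant_iff by simp
  have half: "- A [a, b] $ i $ j = A [a, b] $ i $ j" if "(i = 1 \<and> j \<noteq> 1) \<or> (i \<noteq> 1 \<and> j = 1)" for a b i j
    using *[of "-1" 0 a b i j] that exhaust_2[of a] exhaust_2[of b] exhaust_3[of i] exhaust_3[of j]
    by (auto simp: rotate_tensor_2 sum_2 sum_3)
  have quarter: "rotate_tensor 2 (rot 0 1) A [a, b] $ i $ j = A [a, b] $ i $ j" for a b i j
    by (rule *) simp
  have q: "A [2,2] $ 1 $ 1 = A [1,1] $ 1 $ 1" "- A [1,2] $ 1 $ 1 = A [1,2] $ 1 $ 1"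
     "A [1,1] $ 3 $ 3 = A [2,2] $ 2 $ 2" "A [2,2] $ 3 $ 3 = A [1,1] $ 2 $ 2"
     "A [1,1] $ 3 $ 2 = - A [2,2] $ 2 $ 3" "A [2,2] $ 3 $ 2 = - A [1,1] $ 2 $ 3"
     "A [1,2] $ 3 $ 3 = - A [1,2] $ 2 $ 2" "A [1,2] $ 3 $ 2 = A [1,2] $ 2 $ 3"
    using quarter[of 1 1 1 1] quarter[of 1 2 1 1] quarter[of 1 1 3 3] quarter[of 2 2 3 3]
      quarter[of 1 1 3 2] quarter[of 2 2 3 2] quarter[of 1 2 3 3] quarter[of 1 2 3 2]
    by (simp_all add: rotate_tensor_2 sum_2 sum_3 sym)
  \<comment> \<open>The quarter turn does not detect harmonics of degree 4, a rotation by any angle that is not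
    a multiple of \<open>\<pi>/2\<close> does; this one keeps the coefficients rational.\<close>
  have "rotate_tensor 2 (rot (3/5) (4/5)) A [a, b] $ i $ j = A [a, b] $ i $ j" for a b i j
    by (rule *) simp
  from this[of 1 1 2 2] this[of 1 2 2 2]
  have "24 * (A [1,1] $ 2 $ 2 - A [2,2] $ 2 $ 2 - 2 * A [1,2] $ 2 $ 3)
     = 7 * (A [1,1] $ 2 $ 3 - A [2,2] $ 2 $ 3 + 2 * A [1,2] $ 2 $ 2)"
    "7 * (A [1,1] $ 2 $ 2 - A [2,2] $ 2 $ 2 - 2 * A [1,2] $ 2 $ 3)
     = - 24 * (A [1,1] $ 2 $ 3 - A [2,2] $ 2 $ 3 + 2 * A [1,2] $ 2 $ 2)"
    by (simp_all add: rotate_tensor_2 sum_2 sum_3 sym q field_simps)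
  \<comment> \<open>The homogeneous system for the two bracketed defects has determinant 24^2 +
    7^2.\<close>
  then have "A [1,1] $ 2 $ 2 = A [2,2] $ 2 $ 2 + 2 * A [1,2] $ 2 $ 3"
     "A [1,1] $ 2 $ 3 = A [2,2] $ 2 $ 3 - 2 * A [1,2] $ 2 $ 2"
    by simp_all
  with q show ?R
    using half[of 1 2 1 1] half[of 1 3 1 1] half[of 1 2 1 2] half[of 1 3 1 2] half[of 1 2 2 2]
      half[of 1 3 2 2] half[of 2 1 1 1] half[of 3 1 1 1] half[of 2 1 1 2] half[of 3 1 1 2]
      half[of 2 1 2 2] half[of 3 1 2 2]
    by simp
next
  assume R: ?R
  show ?L
    unfolding rotation_invariant_iff unfolding all_lists_length_2
  proof (intro allI impI)
    fix c d :: real assume cd: "c * c + d * d = 1"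
    then have dd: "d * d = 1 - c * c" by simp
    have ddx: "d * (d * x) = x - c * (c * x)" for x
      using arg_cong[OF dd, of "\<lambda>y. y * x"] by (simp add: algebra_simps)
    show "(\<forall>i j. rotate_tensor 2 (rot c d) A [1, 1] $ i $ j = A [1, 1] $ i $ j)
      \<and> (\<forall>i j. rotate_tensor 2 (rot c d) A [1, 2] $ i $ j = A [1, 2] $ i $ j)
      \<and> (\<forall>i j. rotate_tensor 2 (rot c d) A [2, 1] $ i $ j = A [2, 1] $ i $ j)
      \<and> (\<forall>i j. rotate_tensor 2 (rot c d) A [2, 2] $ i $ j = A [2, 2] $ i $ j)"
      by (simp add: R rotate_tensor_2[OF cd] sym forall_3 sum_2 sum_3, (intro conjI)?; simp add: algebra_simps dd ddx)
  qed
qed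

section \<open>Isotropy of the equivalent equations\<close>

text \<open>The power of \<open>lam\<close> common to column j of the three relevant rows of the
  defect. Columns 2 and 3 share it, so \<open>lam\<close> drops out of all isotropy
  conditions.\<close>

definition unit_scale :: "real \<Rightarrow> 3 \<Rightarrow> real" where
  "unit_scale lam j = (if j = 1 then lam ^ 3 else lam ^ 2)"

text \<open>In this and the next two fluxes, \<beta> = 1 involves the x-moments and \<beta> = 2 the
  y-moments, by the same formula. The sign of the xx row and the exchange of directions in the xy
  row reappear in \<open>defect_nth\<close>.\<close>

definition energy_flux :: "real^3^nonconserved \<Rightarrow> 2 \<Rightarrow> 3 \<Rightarrow> real" where
  "energy_flux E \<beta> j = (if \<beta> = 1
     then (if j = 2 then E $ Energy $ 1 - 11 else 0) - 13 * E $ Phi_x $ j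
     else (if j = 3 then E $ Energy $ 1 - 11 else 0) - 13 * E $ Phi_y $ j)"

definition diagonal_flux :: "real^3^nonconserved \<Rightarrow> 2 \<Rightarrow> 3 \<Rightarrow> real" where
  "diagonal_flux E \<beta> j = (if \<beta> = 1
     then (if j = 2 then 17/7 else 0) + 7/5 * E $ Phi_x $ j + 12/35 * E $ X_eps2 $ j
     else (if j = 3 then 17/7 else 0) + 7/5 * E $ Phi_y $ j + 12/35 * E $ Y_eps2 $ j)"

definition shear_flux :: "real^3^nonconserved \<Rightarrow> 2 \<Rightarrow> 3 \<Rightarrow> real" where
  "shear_flux E \<beta> j = (if \<beta> = 1
     then (if j = 2 then 2/7 else 0) - 1/5 * E $ Phi_x $ j - 6/35 * E $ X_eps2 $ j
     else (if j = 3 then 2/7 else 0) - 1/5 * E $ Phi_y $ j - 6/35 * E $ Y_eps2 $ j)"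

section \<open>Explicit entries of the two tensors\<close>

lemma first_tensor_nth:
  assumes "lam \<noteq> 0"
  shows "first_tensor lam E 1 $ 1 $ j = mat 1 $ 2 $ j"
    "first_tensor lam E 2 $ 1 $ j = mat 1 $ 3 $ j"
    "first_tensor lam E 1 $ 2 $ j = 14/13 * lam^2 * mat 1 $ 1 $ j
       + 1/26 * equilibrium_matrix lam E $ Energy $ j + 1/2 * equilibrium_matrix lam E $ Phi_xx $ j"
    "first_tensor lam E 2 $ 2 $ j = equilibrium_matrix lam E $ Phi_xy $ j"
    "first_tensor lam E 1 $ 3 $ j = equilibrium_matrix lam E $ Phi_xy $ j"
    "first_tensor lam E 2 $ 3 $ j = 14/13 * lam^2 * mat 1 $ 1 $ j
       + 1/26 * equilibrium_matrix lam E $ Energy $ j - 1/2 * equilibrium_matrix lam E $ Phi_xx $ j"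
  by (simp_all add: first_tensor_def matrix_matrix_mult_def sum_moment sum_3 sum_nonconserved
      dir_advection_rows[OF assms] equilibrium_moments_def)

lemma dir_advection_stack:
  assumes "lam \<noteq> 0"
  shows "(dir_advection lam 1 ** stack Y) $ Inr Energy $ j = 11 * lam^2 * mat 1 $ 2 $ j + 13 * Y $ Phi_x $ j"
    "(dir_advection lam 2 ** stack Y) $ Inr Energy $ j = 11 * lam^2 * mat 1 $ 3 $ j + 13 * Y $ Phi_y $ j"
    "(dir_advection lam 1 ** stack Y) $ Inr Phi_xx $ j
      = 17/7 * lam^2 * mat 1 $ 2 $ j + 7/5 * Y $ Phi_x $ j + 12/35 / lam^2 * Y $ X_eps2 $ j"
    "(dir_advection lam 2 ** stack Y) $ Inr Phi_xx $ j
      = - (17/7 * lam^2 * mat 1 $ 3 $ j + 7/5 * Y $ Phi_y $ j + 12/35 / lam^2 * Y $ Y_eps2 $ j)"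
    "(dir_advection lam 1 ** stack Y) $ Inr Phi_xy $ j
      = 2/7 * lam^2 * mat 1 $ 3 $ j - 1/5 * Y $ Phi_y $ j - 6/35 / lam^2 * Y $ Y_eps2 $ j"
    "(dir_advection lam 2 ** stack Y) $ Inr Phi_xy $ j
      = 2/7 * lam^2 * mat 1 $ 2 $ j - 1/5 * Y $ Phi_x $ j - 6/35 / lam^2 * Y $ X_eps2 $ j"
  by (simp_all add: matrix_matrix_mult_def sum_moment sum_3 sum_nonconserved dir_advection_rows[OF assms])

text \<open>Under (1) and (2) the product E A_1 survives only in the energy row, as
  E_\<epsilon>^\<rho> times the density row of A_1; the latter is the momentum.\<close>

lemma defect_nth:
  assumes "lam \<noteq> 0"
    and "E $ Energy $ 2 = 0" "E $ Energy $ 3 = 0"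
    and "E $ Phi_xx = 0" "E $ Phi_xy = 0"
  shows "defect lam E \<beta> $ Inr Energy $ j = unit_scale lam j * energy_flux E \<beta> j"
    "defect lam E \<beta> $ Inr Phi_xx $ j = (if \<beta> = 1 then - 1 else 1) * unit_scale lam j * diagonal_flux E \<beta> j"
    "defect lam E \<beta> $ Inr Phi_xy $ j = - unit_scale lam j * shear_flux E (if \<beta> = 1 then 2 else 1) j"
proof -
  have scale: "equilibrium_matrix lam E $ Phi_x $ j = unit_scale lam j * E $ Phi_x $ j"
    "equilibrium_matrix lam E $ Phi_y $ j = unit_scale lam j * E $ Phi_y $ j" for j
    by (simp_all add: equilibrium_matrix_def unit_scale_def)
  have scale5: "12/35 / lam^2 * equilibrium_matrix lam E $ X_eps2 $ j = 12/35 * (unit_scale lam j * E $ X_eps2 $ j)"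
    "12/35 / lam^2 * equilibrium_matrix lam E $ Y_eps2 $ j = 12/35 * (unit_scale lam j * E $ Y_eps2 $ j)"
    "6/35 / lam^2 * equilibrium_matrix lam E $ X_eps2 $ j = 6/35 * (unit_scale lam j * E $ X_eps2 $ j)"
    "6/35 / lam^2 * equilibrium_matrix lam E $ Y_eps2 $ j = 6/35 * (unit_scale lam j * E $ Y_eps2 $ j)" for j
  proof -
    have "lam ^ 5 = lam\<^sup>2 * lam ^ 3" "lam ^ 4 = lam\<^sup>2 * lam\<^sup>2" by (simp_all flip: power_add)
    then have "equilibrium_matrix lam E $ k $ j = lam\<^sup>2 * (unit_scale lam j * E $ k $ j)"
      if "moment_degree k = 5" for k
      using that by (simp add: equilibrium_matrix_def unit_scale_def)
    with assms(1) show "12/35 / lam^2 * equilibrium_matrix lam E $ X_eps2 $ j = 12/35 * (unit_scale lam j * E $ X_eps2 $ j)"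
      "12/35 / lam^2 * equilibrium_matrix lam E $ Y_eps2 $ j = 12/35 * (unit_scale lam j * E $ Y_eps2 $ j)"
      "6/35 / lam^2 * equilibrium_matrix lam E $ X_eps2 $ j = 6/35 * (unit_scale lam j * E $ X_eps2 $ j)"
      "6/35 / lam^2 * equilibrium_matrix lam E $ Y_eps2 $ j = 6/35 * (unit_scale lam j * E $ Y_eps2 $ j)"
      by simp_all
  qed
  have unit: "c * lam^2 * mat 1 $ 2 $ j = unit_scale lam j * (if j = 2 then c else 0)"
    "c * lam^2 * mat 1 $ 3 $ j = unit_scale lam j * (if j = 3 then c else 0)" for c j
    by (auto simp: unit_scale_def mat_def)
  have unit_E: "equilibrium_matrix lam E $ Energy $ 1 * mat 1 $ (if \<beta> = 1 then 2 else 3) $ j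
     = unit_scale lam j * (if j = (if \<beta> = 1 then 2 else 3) then E $ Energy $ 1 else 0)" for \<beta> :: 2
    by (auto simp: equilibrium_matrix_def unit_scale_def mat_def)
  have advection: "(dir_advection lam 1 ** equilibrium_moments lam E) $ Inr Energy $ j
      = unit_scale lam j * ((if j = 2 then 11 else 0) + 13 * E $ Phi_x $ j)"
    "(dir_advection lam 2 ** equilibrium_moments lam E) $ Inr Energy $ j
      = unit_scale lam j * ((if j = 3 then 11 else 0) + 13 * E $ Phi_y $ j)"
    "(dir_advection lam 1 ** equilibrium_moments lam E) $ Inr Phi_xx $ j = unit_scale lam j * diagonal_flux E 1 j"
    "(dir_advection lam 2 ** equilibrium_moments lam E) $ Inr Phi_xx $ j = - (unit_scale lam j * diagonal_flux E 2 j)"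
    "(dir_advection lam 1 ** equilibrium_moments lam E) $ Inr Phi_xy $ j = unit_scale lam j * shear_flux E 2 j"
    "(dir_advection lam 2 ** equilibrium_moments lam E) $ Inr Phi_xy $ j = unit_scale lam j * shear_flux E 1 j" for j
    unfolding equilibrium_moments_def dir_advection_stack[OF assms(1)] unit scale scale5
    by (simp_all add: diagonal_flux_def shear_flux_def algebra_simps)
  have e: "equilibrium_matrix lam E $ Energy $ 2 = 0" "equilibrium_matrix lam E $ Energy $ 3 = 0"
    "equilibrium_matrix lam E $ Phi_xx $ l = 0" "equilibrium_matrix lam E $ Phi_xy $ l = 0" for l
    by (simp_all add: equilibrium_matrix_def assms(2-5))
  have stack_mult: "(equilibrium_moments lam E ** X) $ Inr k $ j
      = (\<Sum>l\<in>UNIV. equilibrium_matrix lam E $ k $ l * X $ l $ j)" for X k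
    by (simp add: matrix_matrix_mult_def equilibrium_moments_def)
  have "(equilibrium_moments lam E ** first_tensor lam E \<beta>) $ Inr Energy $ j
      = unit_scale lam j * (if j = (if \<beta> = 1 then 2 else 3) then E $ Energy $ 1 else 0)"
    "(equilibrium_moments lam E ** first_tensor lam E \<beta>) $ Inr Phi_xx $ j = 0"
    "(equilibrium_moments lam E ** first_tensor lam E \<beta>) $ Inr Phi_xy $ j = 0"
    using exhaust_2[of \<beta>] unfolding stack_mult unit_E[symmetric]
    by (auto simp: sum_3 e first_tensor_nth[OF assms(1)])
  then show "defect lam E \<beta> $ Inr Energy $ j = unit_scale lam j * energy_flux E \<beta> j"
    "defect lam E \<beta> $ Inr Phi_xx $ j = (if \<beta> = 1 then - 1 else 1) * unit_scale lam j * diagonal_flux E \<beta> j"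
    "defect lam E \<beta> $ Inr Phi_xy $ j = - unit_scale lam j * shear_flux E (if \<beta> = 1 then 2 else 1) j"
    using exhaust_2[of \<beta>]
    by (auto simp: defect_def advection energy_flux_def algebra_simps)
qed

text \<open>The flux of the density is the momentum, itself conserved, so the density row vanishes.
  The factors 1/26 and 1/2 come from expanding (v^x)^2 and (v^y)^2 in moments.\<close>

lemma second_tensor_nth:
  assumes "lam \<noteq> 0"
    and "E $ Energy $ 2 = 0" "E $ Energy $ 3 = 0"
    and "E $ Phi_xx = 0" "E $ Phi_xy = 0"
  shows "second_tensor lam s E \<alpha> \<beta> $ 1 $ j = 0"
    and "second_tensor lam s E 1 \<beta> $ 2 $ j = unit_scale lam j * (relax_sigma s Energy / 26 * energy_flux E \<beta> j
       + (if \<beta> = 1 then - 1 else 1) * relax_sigma s Phi_xx / 2 * diagonal_flux E \<beta> j)"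
    and "second_tensor lam s E 2 \<beta> $ 3 $ j = unit_scale lam j * (relax_sigma s Energy / 26 * energy_flux E \<beta> j
       - (if \<beta> = 1 then - 1 else 1) * relax_sigma s Phi_xx / 2 * diagonal_flux E \<beta> j)"
    and "second_tensor lam s E 2 \<beta> $ 2 $ j = - unit_scale lam j * relax_sigma s Phi_xy * shear_flux E (if \<beta> = 1 then 2 else 1) j"
    and "second_tensor lam s E 1 \<beta> $ 3 $ j = - unit_scale lam j * relax_sigma s Phi_xy * shear_flux E (if \<beta> = 1 then 2 else 1) j"
proof -
  show "second_tensor lam s E \<alpha> \<beta> $ 1 $ j = 0"
    using exhaust_2[of \<alpha>] by (auto simp: second_tensor_def sum_nonconserved dir_advection_rows[OF assms(1)])
qed (simp_all add: second_tensor_def sum_nonconserved dir_advection_rows[OF assms(1)] defect_nth[OF assms] algebra_simps)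

lemma isotropic_at_order_2_iff:
  assumes "lam \<noteq> 0" "\<And>k. s k \<noteq> 0"
  shows "isotropic_at_order lam s E 2 \<longleftrightarrow>
   (\<forall>r. rotation_matrix r \<longrightarrow> (\<forall>\<alpha>s. length \<alpha>s = Suc 0 \<longrightarrow>
      rotate_tensor (Suc 0) r (equivalent_tensor lam s E (Suc 0)) \<alpha>s = equivalent_tensor lam s E (Suc 0) \<alpha>s))
   \<and> (\<forall>r. rotation_matrix r \<longrightarrow> (\<forall>\<alpha>s. length \<alpha>s = 2 \<longrightarrow>
      rotate_tensor 2 r (equivalent_tensor lam s E 2) \<alpha>s = equivalent_tensor lam s E 2 \<alpha>s))"
proof -
  have "{1..2::nat} = {Suc 0, 2}" by auto
  then have "(\<forall>n\<in>{1..2::nat}. P n) \<longleftrightarrow> P (Suc 0) \<and> P 2" for P by simp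
  moreover have "(\<forall>r. P r \<longrightarrow> Q r \<and> Q' r) \<longleftrightarrow> (\<forall>r. P r \<longrightarrow> Q r) \<and> (\<forall>r. P r \<longrightarrow> Q' r)"
    for P Q Q' :: "real^2^2 \<Rightarrow> bool" by blast
  ultimately show ?thesis unfolding isotropic_at_order_def by (simp only:)
qed

text \<open>Parity kills the momentum columns of energy, xx and xy; the quarter turn kills the
  density entries of xx and xy. The density entry of the energy stays free: it is the isotropic
  pressure.\<close>

lemma first_order_isotropic_iff:
  assumes "lam \<noteq> 0" "\<And>k. s k \<noteq> 0"
  shows "(\<forall>r. rotation_matrix r \<longrightarrow> (\<forall>\<alpha>s. length \<alpha>s = Suc 0 \<longrightarrow>
      rotate_tensor (Suc 0) r (equivalent_tensor lam s E (Suc 0)) \<alpha>s = equivalent_tensor lam s E (Suc 0) \<alpha>s))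
   \<longleftrightarrow> E $ Energy $ 2 = 0 \<and> E $ Energy $ 3 = 0 \<and> E $ Phi_xx = 0 \<and> E $ Phi_xy = 0"
proof -
  have A: "equivalent_tensor lam s E (Suc 0) [a] = first_tensor lam E a" for a
    by (simp add: equivalent_tensor_1[OF moment_matrix_inverse[OF assms(1)] assms(2)])
  have e: "equilibrium_matrix lam E $ k $ j = 0 \<longleftrightarrow> E $ k $ j = 0" for k j
    using assms(1) by (simp add: equilibrium_matrix_def)
  have mat: "(mat 1 :: real^3^3) $ 1 $ 1 = 1" "(mat 1 :: real^3^3) $ 1 $ 2 = 0" "(mat 1 :: real^3^3) $ 1 $ 3 = 0"
    "(mat 1 :: real^3^3) $ 2 $ 1 = 0" "(mat 1 :: real^3^3) $ 2 $ 2 = 1" "(mat 1 :: real^3^3) $ 2 $ 3 = 0"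
    "(mat 1 :: real^3^3) $ 3 $ 1 = 0" "(mat 1 :: real^3^3) $ 3 $ 2 = 0" "(mat 1 :: real^3^3) $ 3 $ 3 = 1"
    by (simp_all add: mat_def)
  have zero: "v = 0 \<longleftrightarrow> v $ 1 = 0 \<and> v $ 2 = 0 \<and> v $ 3 = 0" for v :: "real^3"
    by (simp add: vec_eq_iff forall_3)
  show ?thesis
    unfolding rotation_invariant_1 A first_tensor_nth[OF assms(1)] mat zero e[symmetric]
    by (rule iffI; elim conjE; intro conjI; linarith)
qed

text \<open>The first equation gives y = - 7/6 x, which collapses 7/5 x + 12/35 y to x; positivity
  then forces x = 0.\<close>

lemma flux_cancellation:
  fixes x y :: real
  assumes "- 1/5 * x - 6/35 * y = 0" "p * (13 * x) + q / 2 * (7/5 * x + 12/35 * y) = 0" "p > 0" "q > 0"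
  shows "x = 0" "y = 0"
proof -
  have y: "y = - 7/6 * x" using assms(1) by simp
  have "(13 * p + q / 2) * x = 0" using assms(2) unfolding y by (simp add: algebra_simps)
  moreover have "13 * p + q / 2 > 0" using assms(3,4) by (simp add: add_pos_pos)
  ultimately show "x = 0" by simp
  then show "y = 0" by (simp add: y)
qed

lemma second_order_isotropic_iff:
  assumes lam: "lam \<noteq> 0" and s: "\<And>k. s k \<noteq> 0"
    and sigma: "relax_sigma s Energy > 0" "relax_sigma s Phi_xx > 0" "relax_sigma s Phi_xy > 0"
    and E: "E $ Energy $ 2 = 0" "E $ Energy $ 3 = 0" "E $ Phi_xx = 0" "E $ Phi_xy = 0"
  shows "(\<forall>r. rotation_matrix r \<longrightarrow> (\<forall>\<alpha>s. length \<alpha>s = 2 \<longrightarrow>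
      rotate_tensor 2 r (equivalent_tensor lam s E 2) \<alpha>s = equivalent_tensor lam s E 2 \<alpha>s))
   \<longleftrightarrow> (E $ Phi_x $ 1 = 0 \<and> E $ Phi_y $ 1 = 0 \<and>
       E $ Phi_y $ 3 = E $ Phi_x $ 2 \<and> E $ Phi_y $ 2 = - (E $ Phi_x $ 3))
    \<and> (E $ X_eps2 $ 1 = 0 \<and> E $ Y_eps2 $ 1 = 0 \<and>
       E $ Y_eps2 $ 3 = E $ X_eps2 $ 2 \<and> E $ Y_eps2 $ 2 = - (E $ X_eps2 $ 3))
    \<and> relax_sigma s Phi_xx * diagonal_flux E 1 2 = 2 * relax_sigma s Phi_xy * shear_flux E 1 2
    \<and> relax_sigma s Phi_xx * diagonal_flux E 1 3 = 2 * relax_sigma s Phi_xy * shear_flux E 1 3"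
  (is "?L \<longleftrightarrow> ?R")
proof -
  define A where "A = equivalent_tensor lam s E 2"
  define p where "p = relax_sigma s Energy / 26"
  define q where "q = relax_sigma s Phi_xx"
  define t where "t = relax_sigma s Phi_xy"
  define e where "e = energy_flux E"
  define u where "u = diagonal_flux E"
  define w where "w = shear_flux E"
  note defs = p_def[symmetric] q_def[symmetric] t_def[symmetric] e_def[symmetric] u_def[symmetric] w_def[symmetric]
  have pos: "p > 0" "q > 0" "t > 0" using sigma by (simp_all add: p_def q_def t_def)
  have half: "A [a, b] $ i $ j = (second_tensor lam s E a b $ i $ j + second_tensor lam s E b a $ i $ j) / 2"
    for a b i j
    by (simp add: A_def equivalent_tensor_2[OF moment_matrix_inverse[OF lam] s])
  note entries = second_tensor_nth[OF lam E, where s = s, unfolded defs]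
  have top: "A [a, b] $ 1 $ j = 0" for a b j
    by (simp add: half entries)
  have A: "A [1,1] $ 2 $ j = unit_scale lam j * (p * e 1 j - q / 2 * u 1 j)"
    "A [1,1] $ 3 $ j = unit_scale lam j * (- t * w 2 j)"
    "A [2,2] $ 2 $ j = unit_scale lam j * (- t * w 1 j)"
    "A [2,2] $ 3 $ j = unit_scale lam j * (p * e 2 j - q / 2 * u 2 j)"
    "A [1,2] $ 2 $ j = unit_scale lam j * ((p * e 2 j + q / 2 * u 2 j - t * w 2 j) / 2)"
    "A [1,2] $ 3 $ j = unit_scale lam j * ((p * e 1 j + q / 2 * u 1 j - t * w 1 j) / 2)" for j
    by (simp_all add: half entries field_simps)
  have scale: "unit_scale lam 1 \<noteq> 0" "unit_scale lam 2 \<noteq> 0" and "unit_scale lam 3 = unit_scale lam 2"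
    using lam by (simp_all add: unit_scale_def)
  have cancel: "unit_scale lam 2 * x = unit_scale lam 2 * y \<longleftrightarrow> x = y"
    "unit_scale lam 2 * x = - (unit_scale lam 2 * y) \<longleftrightarrow> x = - y"
    "unit_scale lam 2 * x = unit_scale lam 2 * y + 2 * (unit_scale lam 2 * z) \<longleftrightarrow> x = y + 2 * z"
    "unit_scale lam 2 * x = unit_scale lam 2 * y - 2 * (unit_scale lam 2 * z) \<longleftrightarrow> x = y - 2 * z"
    for x y z
  proof -
    have "unit_scale lam 2 * y + 2 * (unit_scale lam 2 * z) = unit_scale lam 2 * (y + 2 * z)"
      "unit_scale lam 2 * y - 2 * (unit_scale lam 2 * z) = unit_scale lam 2 * (y - 2 * z)"
      "- (unit_scale lam 2 * y) = unit_scale lam 2 * (- y)"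
      by (simp_all add: algebra_simps)
    with scale(2) show "unit_scale lam 2 * x = unit_scale lam 2 * y \<longleftrightarrow> x = y"
      "unit_scale lam 2 * x = - (unit_scale lam 2 * y) \<longleftrightarrow> x = - y"
      "unit_scale lam 2 * x = unit_scale lam 2 * y + 2 * (unit_scale lam 2 * z) \<longleftrightarrow> x = y + 2 * z"
      "unit_scale lam 2 * x = unit_scale lam 2 * y - 2 * (unit_scale lam 2 * z) \<longleftrightarrow> x = y - 2 * z"
      by (simp_all only: mult_cancel_left) simp_all
  qed
  \<comment> \<open>These are the conditions of \<open>rotation_invariant_2\<close> without the
    trivial ones on the density row, freed of \<open>lam\<close>.\<close>
  have "?L \<longleftrightarrow>
      p * e 1 1 - q / 2 * u 1 1 = 0 \<and> - t * w 2 1 = 0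
    \<and> (p * e 2 1 + q / 2 * u 2 1 - t * w 2 1) / 2 = 0 \<and> (p * e 1 1 + q / 2 * u 1 1 - t * w 1 1) / 2 = 0
    \<and> - t * w 1 1 = 0 \<and> p * e 2 1 - q / 2 * u 2 1 = 0
    \<and> - t * w 2 3 = - t * w 1 2 \<and> p * e 2 3 - q / 2 * u 2 3 = p * e 1 2 - q / 2 * u 1 2
    \<and> - t * w 2 2 = - (- t * w 1 3) \<and> p * e 2 2 - q / 2 * u 2 2 = - (p * e 1 3 - q / 2 * u 1 3)
    \<and> (p * e 1 3 + q / 2 * u 1 3 - t * w 1 3) / 2 = - ((p * e 2 2 + q / 2 * u 2 2 - t * w 2 2) / 2)
    \<and> (p * e 1 2 + q / 2 * u 1 2 - t * w 1 2) / 2 = (p * e 2 3 + q / 2 * u 2 3 - t * w 2 3) / 2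
    \<and> p * e 1 2 - q / 2 * u 1 2 = - t * w 1 2 + 2 * ((p * e 2 3 + q / 2 * u 2 3 - t * w 2 3) / 2)
    \<and> p * e 1 3 - q / 2 * u 1 3 = - t * w 1 3 - 2 * ((p * e 2 2 + q / 2 * u 2 2 - t * w 2 2) / 2)"
    (is "_ \<longleftrightarrow> ?C")
  proof -
    have "A [2, 1] = A [1, 2]" by (simp add: vec_eq_iff half add.commute)
    then show ?thesis
      unfolding A_def[symmetric] rotation_invariant_2[OF \<open>A [2, 1] = A [1, 2]\<close>] top A
        \<open>unit_scale lam 3 = unit_scale lam 2\<close> cancel mult_eq_0_iff[of "unit_scale lam 1"]
      using scale(1) by blast
  qed
  also have "?C \<longleftrightarrow> ?R"
  proof
    assume C: ?C
    have c: "p * e 1 1 - q / 2 * u 1 1 = 0" "p * e 2 1 - q / 2 * u 2 1 = 0"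
      "p * e 2 3 - q / 2 * u 2 3 = p * e 1 2 - q / 2 * u 1 2"
      "p * e 2 2 - q / 2 * u 2 2 = - (p * e 1 3 - q / 2 * u 1 3)"
      "p * e 1 2 - q / 2 * u 1 2 = - t * w 1 2 + 2 * ((p * e 2 3 + q / 2 * u 2 3 - t * w 2 3) / 2)"
      "p * e 1 3 - q / 2 * u 1 3 = - t * w 1 3 - 2 * ((p * e 2 2 + q / 2 * u 2 2 - t * w 2 2) / 2)"
      and tw: "- t * w 1 1 = 0" "- t * w 2 1 = 0" "- t * w 2 3 = - t * w 1 2" "- t * w 2 2 = - (- t * w 1 3)"
      using C by blast+
    have "t * (w 2 2 + w 1 3) = 0" using tw(4) by (simp add: algebra_simps)
    then have w1: "w 1 1 = 0" "w 2 1 = 0" "w 2 3 = w 1 2" "w 2 2 = - w 1 3"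
      using tw(1-3) pos(3) by (simp_all add: eq_neg_iff_add_eq_0)
    have "E $ Phi_x $ 1 = 0" "E $ X_eps2 $ 1 = 0"
    proof -
      have 1: "- 1/5 * E $ Phi_x $ 1 - 6/35 * E $ X_eps2 $ 1 = 0"
        using w1(1) by (simp add: w_def shear_flux_def)
      have 2: "p * (13 * E $ Phi_x $ 1) + q / 2 * (7/5 * E $ Phi_x $ 1 + 12/35 * E $ X_eps2 $ 1) = 0"
        using c(1) by (simp add: e_def energy_flux_def u_def diagonal_flux_def algebra_simps)
      show "E $ Phi_x $ 1 = 0" "E $ X_eps2 $ 1 = 0"
        using flux_cancellation[OF 1 2 pos(1,2)] by simp_all
    qed
    moreover have "E $ Phi_y $ 1 = 0" "E $ Y_eps2 $ 1 = 0"
    proof -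
      have 1: "- 1/5 * E $ Phi_y $ 1 - 6/35 * E $ Y_eps2 $ 1 = 0"
        using w1(2) by (simp add: w_def shear_flux_def)
      have 2: "p * (13 * E $ Phi_y $ 1) + q / 2 * (7/5 * E $ Phi_y $ 1 + 12/35 * E $ Y_eps2 $ 1) = 0"
        using c(2) by (simp add: e_def energy_flux_def u_def diagonal_flux_def algebra_simps)
      show "E $ Phi_y $ 1 = 0" "E $ Y_eps2 $ 1 = 0"
        using flux_cancellation[OF 1 2 pos(1,2)] by simp_all
    qed
    \<comment> \<open>The unknowns are now deviations from a rotation-dilatation; the term
      E_\<epsilon>^\<rho> - 11 cancels in the difference.\<close>
    moreover have d: "E $ Phi_x $ 2 - E $ Phi_y $ 3 = 0" "E $ X_eps2 $ 2 - E $ Y_eps2 $ 3 = 0"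
    proof -
      have 1: "- 1/5 * (E $ Phi_x $ 2 - E $ Phi_y $ 3) - 6/35 * (E $ X_eps2 $ 2 - E $ Y_eps2 $ 3) = 0"
        using w1(3) by (simp add: w_def shear_flux_def field_simps)
      have "p * (e 2 3 - e 1 2) + q / 2 * (u 1 2 - u 2 3) = 0" using c(3) by (simp add: algebra_simps)
      moreover have "e 2 3 - e 1 2 = 13 * (E $ Phi_x $ 2 - E $ Phi_y $ 3)"
        "u 1 2 - u 2 3 = 7/5 * (E $ Phi_x $ 2 - E $ Phi_y $ 3) + 12/35 * (E $ X_eps2 $ 2 - E $ Y_eps2 $ 3)"
        by (simp_all add: e_def energy_flux_def u_def diagonal_flux_def field_simps)
      ultimately have 2: "p * (13 * (E $ Phi_x $ 2 - E $ Phi_y $ 3)) + q / 2 *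
         (7/5 * (E $ Phi_x $ 2 - E $ Phi_y $ 3) + 12/35 * (E $ X_eps2 $ 2 - E $ Y_eps2 $ 3)) = 0"
        by simp
      show "E $ Phi_x $ 2 - E $ Phi_y $ 3 = 0" "E $ X_eps2 $ 2 - E $ Y_eps2 $ 3 = 0"
        using flux_cancellation[OF 1 2 pos(1,2)] by simp_all
    qed
    moreover have d': "E $ Phi_x $ 3 + E $ Phi_y $ 2 = 0" "E $ X_eps2 $ 3 + E $ Y_eps2 $ 2 = 0"
    proof -
      have 1: "- 1/5 * (E $ Phi_x $ 3 + E $ Phi_y $ 2) - 6/35 * (E $ X_eps2 $ 3 + E $ Y_eps2 $ 2) = 0"
        using w1(4) by (simp add: w_def shear_flux_def field_simps)
      have "p * (- e 2 2 - e 1 3) + q / 2 * (u 1 3 + u 2 2) = 0" using c(4) by (simp add: algebra_simps)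
      moreover have "- e 2 2 - e 1 3 = 13 * (E $ Phi_x $ 3 + E $ Phi_y $ 2)"
        "u 1 3 + u 2 2 = 7/5 * (E $ Phi_x $ 3 + E $ Phi_y $ 2) + 12/35 * (E $ X_eps2 $ 3 + E $ Y_eps2 $ 2)"
        by (simp_all add: e_def energy_flux_def u_def diagonal_flux_def field_simps)
      ultimately have 2: "p * (13 * (E $ Phi_x $ 3 + E $ Phi_y $ 2)) + q / 2 *
         (7/5 * (E $ Phi_x $ 3 + E $ Phi_y $ 2) + 12/35 * (E $ X_eps2 $ 3 + E $ Y_eps2 $ 2)) = 0"
        by simp
      show "E $ Phi_x $ 3 + E $ Phi_y $ 2 = 0" "E $ X_eps2 $ 3 + E $ Y_eps2 $ 2 = 0"
        using flux_cancellation[OF 1 2 pos(1,2)] by simp_all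
    qed
    \<comment> \<open>Given (3) and (4), the energy terms on both sides of the degree-4 condition
      coincide; hence (5) does not contain \<sigma> of the energy.\<close>
    moreover have "q * u 1 2 = 2 * t * w 1 2"
    proof -
      have "e 2 3 = e 1 2" "u 2 3 = u 1 2"
        using d by (simp_all add: e_def energy_flux_def u_def diagonal_flux_def)
      then show ?thesis using c(5) w1(3) by (simp add: field_simps)
    qed
    moreover have "q * u 1 3 = 2 * t * w 1 3"
    proof -
      have "e 2 2 = - e 1 3" "u 2 2 = - u 1 3"
        using d' by (simp_all add: e_def energy_flux_def u_def diagonal_flux_def)
      then show ?thesis using c(6) w1(4) by (simp add: field_simps)
    qed
    ultimately show ?R unfolding defs by (simp add: eq_neg_iff_add_eq_0)
  next
    assume R: ?R
    have "e 1 1 = 0" "e 2 1 = 0" "u 1 1 = 0" "u 2 1 = 0" "w 1 1 = 0" "w 2 1 = 0"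
      "e 2 3 = e 1 2" "u 2 3 = u 1 2" "w 2 3 = w 1 2"
      "e 2 2 = - e 1 3" "u 2 2 = - u 1 3" "w 2 2 = - w 1 3"
      using R by (simp_all add: e_def energy_flux_def u_def diagonal_flux_def w_def shear_flux_def)
    moreover have "q * u 1 2 = 2 * t * w 1 2" "q * u 1 3 = 2 * t * w 1 3"
      using R unfolding defs by simp_all
    ultimately show ?C by (simp add: field_simps)
  qed
  finally show ?thesis .
qed

text \<open>The unknown occurs with coefficient 12/35 (q + t): this is the source of the denominator
  and of 1/12, and positivity makes the equation solvable.\<close>

lemma relaxation_relation:
  fixes q t F X Y G :: real
  assumes "q > 0" "t > 0"
  shows "q * (17/7 + 7/5 * F + 12/35 * X) = 2 * t * (2/7 - 1/5 * F - 6/35 * X)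
      \<longleftrightarrow> X = - (1/12) * ((7 * (7 * q + 2 * t) * F + 5 * (17 * q - 4 * t)) / (q + t))"
    and "q * (7/5 * G + 12/35 * Y) = 2 * t * (- 1/5 * G - 6/35 * Y)
      \<longleftrightarrow> Y = 7/12 * (- G) * ((7 * q + 2 * t) / (q + t))"
proof -
  have "q + t \<noteq> 0" using assms by simp
  then show "q * (17/7 + 7/5 * F + 12/35 * X) = 2 * t * (2/7 - 1/5 * F - 6/35 * X)
      \<longleftrightarrow> X = - (1/12) * ((7 * (7 * q + 2 * t) * F + 5 * (17 * q - 4 * t)) / (q + t))"
    "q * (7/5 * G + 12/35 * Y) = 2 * t * (- 1/5 * G - 6/35 * Y)
      \<longleftrightarrow> Y = 7/12 * (- G) * ((7 * q + 2 * t) / (q + t))"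
    by (simp_all add: field_simps) linarith+
qed

theorem lemma22:
  fixes lam :: real
    and s :: "nonconserved \<Rightarrow> real"
    and E :: "real^3^nonconserved"
  assumes "lam > 0"
    and "\<And>k. 0 < s k" and "\<And>k. s k < 2"
  shows "isotropic_at_order lam s E 2 \<longleftrightarrow>
      (E $ Energy $ 2 = 0 \<and> E $ Energy $ 3 = 0)
    \<and> (E $ Phi_xx $ 1 = 0 \<and> E $ Phi_xx $ 2 = 0 \<and> E $ Phi_xx $ 3 = 0 \<and>
       E $ Phi_xy $ 1 = 0 \<and> E $ Phi_xy $ 2 = 0 \<and> E $ Phi_xy $ 3 = 0)
    \<and> (E $ Phi_x $ 1 = 0 \<and> E $ Phi_y $ 1 = 0 \<and>
       E $ Phi_y $ 3 = E $ Phi_x $ 2 \<and> E $ Phi_y $ 2 = - (E $ Phi_x $ 3))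
    \<and> (E $ X_eps2 $ 1 = 0 \<and> E $ Y_eps2 $ 1 = 0 \<and>
       E $ Y_eps2 $ 3 = E $ X_eps2 $ 2 \<and> E $ Y_eps2 $ 2 = - (E $ X_eps2 $ 3))
    \<and> (E $ X_eps2 $ 2 =
         - (1/12) * ((7 * (7 * relax_sigma s Phi_xx + 2 * relax_sigma s Phi_xy) * E $ Phi_x $ 2
                      + 5 * (17 * relax_sigma s Phi_xx - 4 * relax_sigma s Phi_xy))
                     / (relax_sigma s Phi_xx + relax_sigma s Phi_xy)) \<and>
       E $ X_eps2 $ 3 =
         7/12 * E $ Phi_y $ 2 * ((7 * relax_sigma s Phi_xx + 2 * relax_sigma s Phi_xy)
                                 / (relax_sigma s Phi_xx + relax_sigma s Phi_xy)))"
  (is "_ \<longleftrightarrow> ?rhs")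
proof -
  have lam: "lam \<noteq> 0" and s: "\<And>k. s k \<noteq> 0" using assms by (simp_all add: less_imp_neq[symmetric])
  have sigma: "relax_sigma s k > 0" for k
    using assms(2)[of k] assms(3)[of k] by (simp add: relax_sigma_def field_simps)
  have zero: "v = 0 \<longleftrightarrow> v $ 1 = 0 \<and> v $ 2 = 0 \<and> v $ 3 = 0" for v :: "real^3"
    by (simp add: vec_eq_iff forall_3)
  have rel2: "relax_sigma s Phi_xx * diagonal_flux E 1 2 = 2 * relax_sigma s Phi_xy * shear_flux E 1 2
      \<longleftrightarrow> E $ X_eps2 $ 2 = - (1/12) * ((7 * (7 * relax_sigma s Phi_xx + 2 * relax_sigma s Phi_xy) * E $ Phi_x $ 2
                      + 5 * (17 * relax_sigma s Phi_xx - 4 * relax_sigma s Phi_xy))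
                     / (relax_sigma s Phi_xx + relax_sigma s Phi_xy))"
    using relaxation_relation(1)[OF sigma sigma] by (simp add: diagonal_flux_def shear_flux_def)
  \<comment> \<open>The formula for b uses E of \<open>Phi_y\<close> where the flux equation has E
    of \<open>Phi_x\<close>; property (3) translates between them.\<close>
  have rel3: "relax_sigma s Phi_xx * diagonal_flux E 1 3 = 2 * relax_sigma s Phi_xy * shear_flux E 1 3
      \<longleftrightarrow> E $ X_eps2 $ 3 = 7/12 * E $ Phi_y $ 2 * ((7 * relax_sigma s Phi_xx + 2 * relax_sigma s Phi_xy)
                                 / (relax_sigma s Phi_xx + relax_sigma s Phi_xy))"
    if "E $ Phi_y $ 2 = - (E $ Phi_x $ 3)"
    using relaxation_relation(2)[OF sigma sigma] unfolding that
    by (simp add: diagonal_flux_def shear_flux_def)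
  \<comment> \<open>The formulas for A_2 presuppose (1) and (2), which are exactly isotropy of A_1;
    if they fail, both sides are false.\<close>
  show ?thesis
  proof (cases "E $ Energy $ 2 = 0 \<and> E $ Energy $ 3 = 0 \<and> E $ Phi_xx = 0 \<and> E $ Phi_xy = 0")
    case True
    have "isotropic_at_order lam s E 2 \<longleftrightarrow>
         (E $ Phi_x $ 1 = 0 \<and> E $ Phi_y $ 1 = 0 \<and>
           E $ Phi_y $ 3 = E $ Phi_x $ 2 \<and> E $ Phi_y $ 2 = - (E $ Phi_x $ 3))
        \<and> (E $ X_eps2 $ 1 = 0 \<and> E $ Y_eps2 $ 1 = 0 \<and>
           E $ Y_eps2 $ 3 = E $ X_eps2 $ 2 \<and> E $ Y_eps2 $ 2 = - (E $ X_eps2 $ 3))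
        \<and> relax_sigma s Phi_xx * diagonal_flux E 1 2 = 2 * relax_sigma s Phi_xy * shear_flux E 1 2
        \<and> relax_sigma s Phi_xx * diagonal_flux E 1 3 = 2 * relax_sigma s Phi_xy * shear_flux E 1 3"
      unfolding isotropic_at_order_2_iff[OF lam s] first_order_isotropic_iff[OF lam s]
      using True second_order_isotropic_iff[OF lam s sigma sigma sigma, of E] by blast
    also have "\<dots> \<longleftrightarrow> ?rhs"
      using True rel3 unfolding rel2 zero by blast
    finally show ?thesis .
  next
    case False
    then have "\<not> isotropic_at_order lam s E 2"
      unfolding isotropic_at_order_2_iff[OF lam s] first_order_isotropic_iff[OF lam s] by blast
    moreover have "\<not> ?rhs" using False unfolding zero by blast
    ultimately show ?thesis by blast
  qed
qed

end
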